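(* Let $\vec G$ be an orientation of the Coxeter diagram $s_0\overset{4}{-}s_1-\cdots-s_{n-1}$ of $B_n$, with up and down indices in $\pm[n]$ determined as described below. Then the Cambrian lattice $\mathcal C(\vec G)$ is isomorphic to the subposet of the weak order on $B_n$ consisting of the signed permutations whose full notation, regarded as a permutation of $\pm[n]$, avoids $\bar{2}31$.
   Context: $B_n$: signed permutations $x$ of $\pm[n]$ ($x(-i)=-x(i)$), full notation $x_{-n},\dots,x_{-1},x_1,\dots,x_n$; generators $s_0=(-1\ 1)$, $s_i=(i\ i{+}1)(-i{-}1\ {-i})$. Weak order $v\le w$ iff $I(v)\subseteq I(w)$, $I(w)$ the reflections $t$ with $\ell(tw)<\ell(w)$. $\Theta(\vec G)$: smallest lattice congruence of the weak order with $t$ congruent to the element with word $tsts\cdots$ of $m(s,t)-1$ letters for each directed edge $s\to t$ ($m(s_0,s_1)=4$, otherwise 3); $\mathcal C(\vec G)$ is the quotient. Up/down: for $b\in[n-1]$, $b$ is up if $s_b\to s_{b-1}$, down if $s_{b-1}\to s_b$; $n$ is declared up or down arbitrarily; for $b\in[n]$, $-b$ is up iff $b$ is down. A sequence $y_1,\dots,y_{2n}$ (the full notation) contains $\bar{2}31$ if there exist $p<q<r$ with $y_r<y_p<y_q$ and $y_p$ up; otherwise it avoids $\bar{2}31$. *)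

theory Defs
  imports "HOL-Combinatorics.Permutations"
begin

definition pmn :: "nat \<Rightarrow> int set" where
  "pmn n = {x. 1 \<le> \<bar>x\<bar> \<and> \<bar>x\<bar> \<le> int n}"

definition Bn :: "nat \<Rightarrow> (int \<Rightarrow> int) set" where
  "Bn n = {w. w permutes pmn n \<and> (\<forall>i. w (- i) = - w i)}"

definition gen :: "nat \<Rightarrow> int \<Rightarrow> int" where
  "gen i = (if i = 0 then Transposition.transpose (-1) 1
            else Transposition.transpose (int i) (int i + 1) \<circ>
                 Transposition.transpose (- int i - 1) (- int i))"

definition word_prod :: "nat list \<Rightarrow> int \<Rightarrow> int" where
  "word_prod ws = foldr (\<lambda>i f. gen i \<circ> f) ws id"

definition is_word :: "nat \<Rightarrow> nat list \<Rightarrow> bool" where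
  "is_word n ws \<longleftrightarrow> (\<forall>i\<in>set ws. i < n)"

definition len :: "nat \<Rightarrow> (int \<Rightarrow> int) \<Rightarrow> nat" where
  "len n w = (LEAST k. \<exists>ws. is_word n ws \<and> length ws = k \<and> word_prod ws = w)"

definition refls :: "nat \<Rightarrow> (int \<Rightarrow> int) set" where
  "refls n = {w \<circ> gen i \<circ> inv w | w i. w \<in> Bn n \<and> i < n}"

definition inv_set :: "nat \<Rightarrow> (int \<Rightarrow> int) \<Rightarrow> (int \<Rightarrow> int) set" where
  "inv_set n w = {t \<in> refls n. len n (t \<circ> w) < len n w}"

definition weak_le :: "nat \<Rightarrow> (int \<Rightarrow> int) \<Rightarrow> (int \<Rightarrow> int) \<Rightarrow> bool" where
  "weak_le n v w \<longleftrightarrow> inv_set n v \<subseteq> inv_set n w"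

definition is_meet :: "'a set \<Rightarrow> ('a \<Rightarrow> 'a \<Rightarrow> bool) \<Rightarrow> 'a \<Rightarrow> 'a \<Rightarrow> 'a \<Rightarrow> bool" where
  "is_meet A le x y m \<longleftrightarrow> m \<in> A \<and> le m x \<and> le m y \<and> (\<forall>z\<in>A. le z x \<and> le z y \<longrightarrow> le z m)"

definition is_join :: "'a set \<Rightarrow> ('a \<Rightarrow> 'a \<Rightarrow> bool) \<Rightarrow> 'a \<Rightarrow> 'a \<Rightarrow> 'a \<Rightarrow> bool" where
  "is_join A le x y m \<longleftrightarrow> m \<in> A \<and> le x m \<and> le y m \<and> (\<forall>z\<in>A. le x z \<and> le y z \<longrightarrow> le m z)"

definition lattice_congruence :: "'a set \<Rightarrow> ('a \<Rightarrow> 'a \<Rightarrow> bool) \<Rightarrow> 'a rel \<Rightarrow> bool" where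
  "lattice_congruence A le R \<longleftrightarrow> equiv A R \<and>
     (\<forall>x y z m m'. (x, y) \<in> R \<longrightarrow> z \<in> A \<longrightarrow> is_meet A le x z m \<longrightarrow> is_meet A le y z m'
        \<longrightarrow> (m, m') \<in> R) \<and>
     (\<forall>x y z m m'. (x, y) \<in> R \<longrightarrow> z \<in> A \<longrightarrow> is_join A le x z m \<longrightarrow> is_join A le y z m'
        \<longrightarrow> (m, m') \<in> R)"

definition gen_congruence :: "'a set \<Rightarrow> ('a \<Rightarrow> 'a \<Rightarrow> bool) \<Rightarrow> 'a rel \<Rightarrow> 'a rel" where
  "gen_congruence A le P = \<Inter> {R. lattice_congruence A le R \<and> P \<subseteq> R}"

definition quot_le :: "('a \<Rightarrow> 'a \<Rightarrow> bool) \<Rightarrow> 'a set \<Rightarrow> 'a set \<Rightarrow> bool" where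
  "quot_le le X Y \<longleftrightarrow> (\<exists>x\<in>X. \<exists>y\<in>Y. le x y)"

text \<open>The orientation is encoded by up :: nat => bool: for b in [n-1],
  up b means the edge s_b -> s_{b-1}, otherwise s_{b-1} -> s_b.
  The value up n is the arbitrary declaration for n.\<close>

fun alt_word :: "nat \<Rightarrow> nat \<Rightarrow> nat \<Rightarrow> nat list" where
  "alt_word t s 0 = []"
| "alt_word t s (Suc k) = t # alt_word s t k"

definition edge_src :: "(nat \<Rightarrow> bool) \<Rightarrow> nat \<Rightarrow> nat" where
  "edge_src up b = (if up b then b else b - 1)"

definition edge_tgt :: "(nat \<Rightarrow> bool) \<Rightarrow> nat \<Rightarrow> nat" where
  "edge_tgt up b = (if up b then b - 1 else b)"

definition coxm :: "nat \<Rightarrow> nat" where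
  "coxm b = (if b = 1 then 4 else 3)"

definition camb_gens :: "nat \<Rightarrow> (nat \<Rightarrow> bool) \<Rightarrow> ((int \<Rightarrow> int) \<times> (int \<Rightarrow> int)) set" where
  "camb_gens n up = {(gen (edge_tgt up b),
                      word_prod (alt_word (edge_tgt up b) (edge_src up b) (coxm b - 1))) | b.
                      1 \<le> b \<and> b \<le> n - 1}"

definition Theta :: "nat \<Rightarrow> (nat \<Rightarrow> bool) \<Rightarrow> (int \<Rightarrow> int) rel" where
  "Theta n up = gen_congruence (Bn n) (weak_le n) (camb_gens n up)"

definition cambrian :: "nat \<Rightarrow> (nat \<Rightarrow> bool) \<Rightarrow> (int \<Rightarrow> int) set set" where
  "cambrian n up = Bn n // Theta n up"

definition is_up :: "(nat \<Rightarrow> bool) \<Rightarrow> int \<Rightarrow> bool" where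
  "is_up up x \<longleftrightarrow> (x > 0 \<and> up (nat x)) \<or> (x < 0 \<and> \<not> up (nat (- x)))"

definition full_notation :: "nat \<Rightarrow> (int \<Rightarrow> int) \<Rightarrow> int list" where
  "full_notation n w = map w ([- int n .. -1] @ [1 .. int n])"

definition avoids_231bar :: "(nat \<Rightarrow> bool) \<Rightarrow> int list \<Rightarrow> bool" where
  "avoids_231bar up y \<longleftrightarrow> \<not> (\<exists>p q r. p < q \<and> q < r \<and> r < length y \<and>
      y ! r < y ! p \<and> y ! p < y ! q \<and> is_up up (y ! p))"

definition avoiders :: "nat \<Rightarrow> (nat \<Rightarrow> bool) \<Rightarrow> (int \<Rightarrow> int) set" where
  "avoiders n up = {w \<in> Bn n. avoids_231bar up (full_notation n w)}"

end

theory Submission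
  imports Defs
begin

text \<open>A signed permutation is determined by its set of inverted pairs of values, and the weak order
  is containment of these sets. The sets that occur are the ones closed under \<open>(a, c) \<mapsto> (- c, - a)\<close>
  that are transitive with transitive complement. For such a set \<open>S\<close>, let \<open>pi_down S\<close> be its largest
  part that contains with \<open>(a, c)\<close> also \<open>(b, c)\<close> for each up \<open>b\<close> and \<open>(a, b)\<close> for each down \<open>b\<close> between
  \<open>a\<close> and \<open>c\<close>. It is again such a set, and \<open>pi_down S = S\<close> describes the avoiders. The map
  \<open>pi_down\<close> is monotone and has the same fibres as the dually defined \<open>pi_up\<close>, so these fibres are
  the classes of a lattice congruence, which contains the generators of \<open>Theta\<close>.

  Conversely, a set that is not fixed by \<open>pi_down\<close> has an adjacent inversion \<open>(a, c)\<close> with an up value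
  \<open>b\<close> strictly between \<open>a\<close> and \<open>c\<close> to the left of both. Every congruence containing the generator
  for \<open>b\<close> (or \<open>- b\<close>) identifies, by a join, the extreme elements \<open>blocks\<close> and \<open>all_but\<close>, and from
  this, by a meet, a join and a meet, the two sides of that inversion. So every such congruence
  contains all fibres of \<open>pi_down\<close>.\<close>

section \<open>Inversions of signed permutations\<close>

definition pairs :: "nat \<Rightarrow> (int \<times> int) set" where
  "pairs n = {(a, c). a \<in> pmn n \<and> c \<in> pmn n \<and> a < c}"

text \<open>Recorded by values, \<open>inv w a\<close> being the position of \<open>a\<close>. A
  pair and its mirror \<open>(- c, - a)\<close> belong to the same reflection; keeping both makes
  the set symmetric.\<close>

definition inversions :: "nat \<Rightarrow> (int \<Rightarrow> int) \<Rightarrow> (int \<times> int) set" where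
  "inversions n w = {(a, c). (a, c) \<in> pairs n \<and> inv w c < inv w a}"

lemma pmn_uminus [simp]: "- x \<in> pmn n \<longleftrightarrow> x \<in> pmn n"
  by (simp add: pmn_def)

lemma zero_notin_pmn [simp]: "0 \<notin> pmn n"
  by (simp add: pmn_def)

lemma finite_pmn: "finite (pmn n)"
proof (rule finite_subset)
  show "pmn n \<subseteq> {- int n..int n}" by (auto simp: pmn_def)
qed simp

lemma finite_pairs: "finite (pairs n)"
  by (rule finite_subset[of _ "pmn n \<times> pmn n"]) (auto simp: pairs_def finite_pmn)

lemma Bn_D:
  assumes "w \<in> Bn n"
  shows "w permutes pmn n" "bij w" "w (- x) = - w x"
  using assms by (auto simp: Bn_def permutes_bij)

lemma Bn_in [simp]: "w \<in> Bn n \<Longrightarrow> w x \<in> pmn n \<longleftrightarrow> x \<in> pmn n"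
  by (meson Bn_D(1) permutes_in_image)

lemma Bn_inv_f [simp]: "w \<in> Bn n \<Longrightarrow> inv w (w x) = x"
  using Bn_D(1) permutes_inverses(2) by metis

lemma Bn_f_inv [simp]: "w \<in> Bn n \<Longrightarrow> w (inv w x) = x"
  using Bn_D(1) permutes_inverses(1) by metis

lemma Bn_eq_iff: "w \<in> Bn n \<Longrightarrow> w x = w y \<longleftrightarrow> x = y"
  by (metis Bn_inv_f)

lemma id_Bn: "id \<in> Bn n"
  by (simp add: Bn_def permutes_id)

lemma comp_Bn: "v \<in> Bn n \<Longrightarrow> w \<in> Bn n \<Longrightarrow> v \<circ> w \<in> Bn n"
  by (simp add: Bn_def permutes_compose)

lemma inv_Bn: "w \<in> Bn n \<Longrightarrow> inv w \<in> Bn n"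
  unfolding Bn_def
  by (smt (verit) mem_Collect_eq permutes_inv permutes_inverses(1) permutes_inverses(2))

lemma inv_inv_Bn: "w \<in> Bn n \<Longrightarrow> inv (inv w) = w"
  by (meson Bn_D(2) inv_inv_eq)

lemma inv_comp_Bn: "v \<in> Bn n \<Longrightarrow> w \<in> Bn n \<Longrightarrow> inv (v \<circ> w) = inv w \<circ> inv v"
  by (meson Bn_D(2) o_inv_distrib)

lemma inv_Bn_uminus: "w \<in> Bn n \<Longrightarrow> inv w (- x) = - inv w x"
  using Bn_D(3) inv_Bn by blast

section \<open>Generators as swaps of neighbouring positions\<close>

lemma gen_Bn:
  assumes "i < n" shows "gen i \<in> Bn n"
proof -
  have "gen i permutes pmn n"
  proof (cases "i = 0")
    case True
    then show ?thesis using assms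
      by (auto simp: gen_def pmn_def intro!: permutes_swap_id)
  next
    case False
    then show ?thesis using assms
      unfolding gen_def by (auto simp: pmn_def intro!: permutes_compose permutes_swap_id)
  qed
  moreover have "gen i (- x) = - gen i x" for x
    by (auto simp: gen_def Transposition.transpose_def)
  ultimately show ?thesis by (simp add: Bn_def)
qed

lemma gen_invol [simp]: "gen i (gen i x) = x"
  by (auto simp: gen_def Transposition.transpose_def)

lemma inv_gen: "inv (gen i) = gen i"
  by (rule inv_unique_comp) (auto simp: fun_eq_iff)

text \<open>Left neighbour of position \<open>int i + 1\<close>. As 0 is not a position, it is
  \<open>- 1\<close> for \<open>i = 0\<close>, which lets \<open>gen 0\<close> be treated like the
  other generators.\<close>

definition prev_pos :: "nat \<Rightarrow> int" where
  "prev_pos i = (if i = 0 then - 1 else int i)"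

lemma gen_flip:
  assumes "x < y" "x \<noteq> 0" "y \<noteq> 0" "gen i y < gen i x"
  shows "(x = prev_pos i \<and> y = int i + 1) \<or> (x = - int i - 1 \<and> y = - prev_pos i)"
  using assms
  by (auto simp: gen_def prev_pos_def Transposition.transpose_def split: if_splits)

lemma gen_apply:
  "gen i (prev_pos i) = int i + 1" "gen i (int i + 1) = prev_pos i"
  "gen i (- prev_pos i) = - int i - 1" "gen i (- int i - 1) = - prev_pos i"
  by (auto simp: gen_def prev_pos_def Transposition.transpose_def)

lemma prev_pos_in: "i < n \<Longrightarrow> prev_pos i \<in> pmn n" "i < n \<Longrightarrow> int i + 1 \<in> pmn n"
  by (auto simp: prev_pos_def pmn_def)

lemma prev_pos_less: "prev_pos i < int i + 1"
  by (auto simp: prev_pos_def)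

lemma gen_mono:
  assumes "x < y" "x \<noteq> 0" "y \<noteq> 0"
    "\<not> (x = prev_pos i \<and> y = int i + 1)" "\<not> (x = - int i - 1 \<and> y = - prev_pos i)"
  shows "gen i x < gen i y"
proof -
  have "gen i x \<noteq> gen i y" using assms(1) by (metis gen_invol order_less_irrefl)
  then show ?thesis using gen_flip[OF assms(1-3), of i] assms(4,5) by linarith
qed

text \<open>Right multiplication acts on positions, and swapping neighbours changes only the order
  of the two entries and of their mirror images. For \<open>i = 0\<close> the two added pairs
  coincide.\<close>

lemma inversions_comp_gen:
  assumes w: "w \<in> Bn n" and i: "i < n" and asc: "w (prev_pos i) < w (int i + 1)"
  shows "inversions n (w \<circ> gen i) =
    inversions n w \<union> {(w (prev_pos i), w (int i + 1)), (- w (int i + 1), - w (prev_pos i))}"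
proof -
  have nz: "inv w x \<noteq> 0" if "x \<in> pmn n" for x
    using that inv_Bn[OF w] by (metis Bn_in zero_notin_pmn)
  have I: "inv (w \<circ> gen i) x = gen i (inv w x)" for x
    by (simp add: inv_comp_Bn[OF w gen_Bn[OF i]] inv_gen)
  note D = Bn_D[OF w]
  have mem: "w (prev_pos i) \<in> pmn n" "w (int i + 1) \<in> pmn n"
    using prev_pos_in[OF i] w by auto
  have eq: "inv w a = x \<longleftrightarrow> a = w x" for a x using w by auto
  have m': "w (- int i - 1) = - w (int i + 1)" using D(3)[of "int i + 1"] by simp
  show ?thesis
  proof (rule set_eqI, clarify)
    fix a c
    show "(a, c) \<in> inversions n (w \<circ> gen i) \<longleftrightarrow> (a, c) \<in> inversions n w \<union>
       {(w (prev_pos i), w (int i + 1)), (- w (int i + 1), - w (prev_pos i))}"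
    proof (cases "(a, c) \<in> pairs n")
      case False
      then show ?thesis using mem asc by (auto simp: inversions_def pairs_def)
    next
      case True
      then have ac: "a < c" "a \<in> pmn n" "c \<in> pmn n" by (auto simp: pairs_def)
      have ne: "inv w a \<noteq> inv w c" using ac(1) eq by (metis order_less_irrefl)
      show ?thesis
      proof (cases "inv w a < inv w c")
        case lt: True
        show ?thesis
        proof (cases "(a, c) \<in> {(w (prev_pos i), w (int i + 1)), (- w (int i + 1), - w (prev_pos i))}")
          case t: True
          then have "gen i (inv w c) < gen i (inv w a)"
          proof
            assume "(a, c) = (w (prev_pos i), w (int i + 1))"
            then show ?thesis using prev_pos_less[of i] w by (simp add: gen_apply)
          next
            assume "(a, c) \<in> {(- w (int i + 1), - w (prev_pos i))}"
            then have "inv w a = - int i - 1" "inv w c = - prev_pos i"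
              using inv_Bn_uminus[OF w] w by auto
            then show ?thesis using prev_pos_less[of i] by (simp add: gen_apply)
          qed
          then have "(a, c) \<in> inversions n (w \<circ> gen i)" using True unfolding inversions_def I by blast
          then show ?thesis using t by blast
        next
          case f: False
          have "\<not> (inv w a = prev_pos i \<and> inv w c = int i + 1)"
            using f eq[of a "prev_pos i"] eq[of c "int i + 1"] by blast
          moreover have "\<not> (inv w a = - int i - 1 \<and> inv w c = - prev_pos i)"
            using f eq[of a "- int i - 1"] eq[of c "- prev_pos i"] m' D(3)[of "prev_pos i"] by auto
          ultimately have "gen i (inv w a) < gen i (inv w c)"
            using lt nz ac by (metis gen_mono)
          then have "(a, c) \<notin> inversions n (w \<circ> gen i)" "(a, c) \<notin> inversions n w"
            using lt unfolding inversions_def I by auto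
          then show ?thesis using f by blast
        qed
      next
        case False
        then have lt: "inv w c < inv w a" using ne by simp
        have "\<not> (inv w c = prev_pos i \<and> inv w a = int i + 1)"
          using eq[of c "prev_pos i"] eq[of a "int i + 1"] ac(1) asc by linarith
        moreover have "\<not> (inv w c = - int i - 1 \<and> inv w a = - prev_pos i)"
          using eq[of c "- int i - 1"] eq[of a "- prev_pos i"] m' D(3)[of "prev_pos i"] ac(1) asc by simp
        ultimately have "gen i (inv w c) < gen i (inv w a)"
          using lt nz ac by (metis gen_mono)
        then have "(a, c) \<in> inversions n (w \<circ> gen i)" "(a, c) \<in> inversions n w"
          using lt True unfolding inversions_def I by auto
        then show ?thesis by blast
      qed
    qed
  qed
qed

lemma inversions_comp_gen_desc:
  assumes w: "w \<in> Bn n" and i: "i < n" and desc: "w (int i + 1) < w (prev_pos i)"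
  shows "inversions n w =
    inversions n (w \<circ> gen i) \<union> {(w (int i + 1), w (prev_pos i)), (- w (prev_pos i), - w (int i + 1))}"
    and "(w (int i + 1), w (prev_pos i)) \<in> inversions n w - inversions n (w \<circ> gen i)"
proof -
  have 1: "w \<circ> gen i \<circ> gen i = w" by (auto simp: fun_eq_iff)
  show "inversions n w =
    inversions n (w \<circ> gen i) \<union> {(w (int i + 1), w (prev_pos i)), (- w (prev_pos i), - w (int i + 1))}"
    using inversions_comp_gen[OF comp_Bn[OF w gen_Bn[OF i]] i] desc by (simp add: 1 gen_apply)
  then show "(w (int i + 1), w (prev_pos i)) \<in> inversions n w - inversions n (w \<circ> gen i)"
    using w prev_pos_less[of i] unfolding inversions_def inv_comp_Bn[OF w gen_Bn[OF i]]
    by (auto simp: inv_gen gen_apply)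
qed

text \<open>The cases are neighbours right of the centre, across it (index 0), and left of it, where
  the mirror image determines the index.\<close>

lemma adjacent_positions:
  assumes "x \<in> pmn n" "y \<in> pmn n" "x < y" "\<And>z. z \<in> pmn n \<Longrightarrow> \<not> (x < z \<and> z < y)"
  obtains i where "i < n" "(x = prev_pos i \<and> y = int i + 1) \<or> (x = - int i - 1 \<and> y = - prev_pos i)"
proof -
  consider "x > 0" | "x = -1" | "x < -1" using assms(1) by (auto simp: pmn_def) linarith
  then show ?thesis
  proof cases
    case 1
    then have "y = x + 1" using assms(1-3) assms(4)[of "x + 1"] by (auto simp: pmn_def)
    then show ?thesis using that[of "nat x"] 1 assms(2) by (auto simp: prev_pos_def pmn_def)
  next
    case 2
    then have "y = 1" using assms(1-3) assms(4)[of 1] by (auto simp: pmn_def)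
    then show ?thesis using that[of 0] 2 assms(2) by (auto simp: prev_pos_def pmn_def)
  next
    case 3
    then have "y = x + 1" using assms(1-3) assms(4)[of "x + 1"] by (auto simp: pmn_def)
    then show ?thesis using that[of "nat (- x - 1)"] 3 assms(1) by (auto simp: prev_pos_def pmn_def)
  qed
qed

lemma adjacent_swap:
  assumes w: "w \<in> Bn n" and ac: "(a, c) \<in> pairs n" "inv w a < inv w c"
    and adj: "\<And>e. e \<in> pmn n \<Longrightarrow> \<not> (inv w a < inv w e \<and> inv w e < inv w c)"
  obtains i where "i < n" "inversions n (w \<circ> gen i) = inversions n w \<union> {(a, c), (- c, - a)}"
proof -
  have m: "inv w a \<in> pmn n" "inv w c \<in> pmn n" "a < c"
    using ac inv_Bn[OF w] by (auto simp: pairs_def)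
  have "\<not> (inv w a < z \<and> z < inv w c)" if "z \<in> pmn n" for z
    using adj[of "w z"] that w by auto
  from adjacent_positions[OF m(1,2) ac(2) this] obtain i where i: "i < n" and
    "(inv w a = prev_pos i \<and> inv w c = int i + 1) \<or> (inv w a = - int i - 1 \<and> inv w c = - prev_pos i)"
    by blast
  then have "(a = w (prev_pos i) \<and> c = w (int i + 1)) \<or> (a = w (- int i - 1) \<and> c = w (- prev_pos i))"
    using w by (metis Bn_f_inv)
  moreover have "w (- int i - 1) = - w (int i + 1)" "w (- prev_pos i) = - w (prev_pos i)"
    using Bn_D(3)[OF w, of "int i + 1"] Bn_D(3)[OF w] by auto
  ultimately have "(a = w (prev_pos i) \<and> c = w (int i + 1)) \<or> (c = - w (prev_pos i) \<and> a = - w (int i + 1))"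
    by auto
  then show ?thesis using that[OF i] inversions_comp_gen[OF w i] m(3) by fastforce
qed

text \<open>Monotonicity makes \<open>p\<close> carry the elements below \<open>x\<close> onto those
  below \<open>p x\<close>, so \<open>x\<close> and \<open>p x\<close> have the same rank in
  \<open>A\<close>.\<close>

lemma strict_mono_permutes_id:
  fixes p :: "int \<Rightarrow> int"
  assumes p: "p permutes A" and A: "finite A" and mono: "\<And>x y. x \<in> A \<Longrightarrow> y \<in> A \<Longrightarrow> x < y \<Longrightarrow> p x < p y"
  shows "p = id"
proof
  fix x
  show "p x = id x"
  proof (cases "x \<in> A")
    case False then show ?thesis using p by (simp add: permutes_not_in)
  next
    case True
    have lt: "p y < p x \<longleftrightarrow> y < x" if "y \<in> A" for y
      using mono[OF that True] mono[OF True that] by (metis not_less_iff_gr_or_eq)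
    have "p ` {y \<in> A. y < x} = {k \<in> A. k < p x}"
    proof
      show "p ` {y \<in> A. y < x} \<subseteq> {k \<in> A. k < p x}" using lt permutes_in_image[OF p] by auto
      show "{k \<in> A. k < p x} \<subseteq> p ` {y \<in> A. y < x}"
      proof
        fix k assume k: "k \<in> {k \<in> A. k < p x}"
        then have pk: "p (inv p k) = k" "inv p k \<in> A"
          using permutes_inverses[OF p] permutes_in_image[OF permutes_inv[OF p]] by auto
        then have "inv p k < x" using lt[of "inv p k"] k by simp
        then show "k \<in> p ` {y \<in> A. y < x}" using pk by (metis (mono_tags, lifting) image_eqI mem_Collect_eq)
      qed
    qed
    then have c: "card {y \<in> A. y < x} = card {k \<in> A. k < p x}"
      using card_image[of p "{y \<in> A. y < x}"] p
      by (metis inj_on_subset permutes_inj subset_UNIV)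
    have px: "p x \<in> A" using True p by (simp add: permutes_in_image)
    have card_less: "card {k \<in> A. k < y} < card {k \<in> A. k < z}" if "y \<in> A" "y < z" for y z
      by (rule psubset_card_mono) (use A that in auto)
    have "\<not> x < p x" "\<not> p x < x"
      using card_less[OF True, of "p x"] card_less[OF px, of x] c by auto
    then show ?thesis by simp
  qed
qed

lemma inversions_empty:
  assumes "w \<in> Bn n" "inversions n w = {}"
  shows "w = id"
proof -
  have "inv w = id"
  proof (rule strict_mono_permutes_id)
    show "inv w permutes pmn n" using Bn_D(1) inv_Bn assms(1) by blast
    show "finite (pmn n)" by (rule finite_pmn)
    fix x y assume "x \<in> pmn n" "y \<in> pmn n" "x < y"
    moreover have "inv w x \<noteq> inv w y" using \<open>x < y\<close> assms(1) by (metis Bn_f_inv order_less_irrefl)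
    ultimately show "inv w x < inv w y" using assms(2) by (force simp: inversions_def pairs_def)
  qed
  then show ?thesis by (metis assms(1) inv_id inv_inv_Bn)
qed

text \<open>An inversion of \<open>inv v \<circ> w\<close> would yield two values that stand in
  different order in \<open>v\<close> and in \<open>w\<close>.\<close>

lemma inversions_inj:
  assumes v: "v \<in> Bn n" and w: "w \<in> Bn n" and eq: "inversions n v = inversions n w"
  shows "v = w"
proof -
  have "inversions n (inv v \<circ> w) = {}"
  proof (rule ccontr)
    assume "inversions n (inv v \<circ> w) \<noteq> {}"
    then obtain x y where xy: "x < y" "x \<in> pmn n" "y \<in> pmn n" "inv w (v y) < inv w (v x)"
      using inv_comp_Bn[OF inv_Bn[OF v] w] inv_inv_Bn[OF v]
      by (auto simp: inversions_def pairs_def)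
    have "v x \<noteq> v y" using xy(1) v by (metis Bn_inv_f order_less_irrefl)
    moreover have "(v x, v y) \<in> inversions n w - inversions n v" if "v x < v y"
      using that xy v by (auto simp: inversions_def pairs_def)
    moreover have "(v y, v x) \<in> inversions n v - inversions n w" if "v y < v x"
      using that xy v by (auto simp: inversions_def pairs_def)
    ultimately show False using eq by (metis DiffE linorder_neqE)
  qed
  then have "inv v \<circ> w = id" using inversions_empty comp_Bn inv_Bn v w by blast
  then show ?thesis using v by (metis Bn_f_inv comp_apply ext id_apply)
qed

section \<open>Reflections and the weak order\<close>

lemma word_prod_simps [simp]: "word_prod [] = id" "word_prod (i # ws) = gen i \<circ> word_prod ws"
  by (simp_all add: word_prod_def)

lemma word_prod_append: "word_prod (us @ ws) = word_prod us \<circ> word_prod ws"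
  by (induction us) (auto simp: fun_eq_iff)

lemma is_word_simps [simp]: "is_word n []" "is_word n (i # ws) \<longleftrightarrow> i < n \<and> is_word n ws"
  "is_word n (us @ ws) \<longleftrightarrow> is_word n us \<and> is_word n ws"
  by (auto simp: is_word_def)

lemma word_prod_Bn: "is_word n ws \<Longrightarrow> word_prod ws \<in> Bn n"
  by (induction ws) (auto simp: id_Bn intro!: comp_Bn gen_Bn)

lemma inversions_id: "inversions n id = {}"
  by (auto simp: inversions_def pairs_def)

lemma inversions_pairs: "inversions n w \<subseteq> pairs n"
  by (auto simp: inversions_def)

lemma finite_inversions: "finite (inversions n w)"
  by (rule finite_subset[OF inversions_pairs finite_pairs])

text \<open>An inversion whose positions are closest is adjacent: an entry between them would form a
  closer inversion with one of the two.\<close>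

lemma inversions_adjacent:
  assumes w: "w \<in> Bn n" and ne: "inversions n w \<noteq> {}"
  obtains i where "i < n" "w (int i + 1) < w (prev_pos i)"
proof -
  obtain x0 where "x0 \<in> inversions n w" using ne by blast
  from ex_has_least_nat[of "\<lambda>x. x \<in> inversions n w", OF this, of "\<lambda>x. nat (inv w (fst x) - inv w (snd x))"]
  obtain x where x: "x \<in> inversions n w" "\<And>y. y \<in> inversions n w \<Longrightarrow>
      nat (inv w (fst x) - inv w (snd x)) \<le> nat (inv w (fst y) - inv w (snd y))"
    by blast
  obtain a c where ac: "(a, c) \<in> inversions n w" and xac: "x = (a, c)"
    using x(1) by (metis surj_pair)
  have least: "nat (inv w a - inv w c) \<le> nat (inv w a' - inv w c')"
    if "(a', c') \<in> inversions n w" for a' c'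
    using x(2)[OF that] xac by simp
  have p: "a \<in> pmn n" "c \<in> pmn n" "a < c" "inv w c < inv w a"
    using ac by (auto simp: inversions_def pairs_def)
  have "\<not> (inv w c < z \<and> z < inv w a)" if "z \<in> pmn n" for z
  proof
    assume z: "inv w c < z \<and> z < inv w a"
    have "(w z, c) \<in> inversions n w" if "w z < c"
      using that z w p \<open>z \<in> pmn n\<close> by (auto simp: inversions_def pairs_def)
    moreover have "(a, w z) \<in> inversions n w" if "a < w z"
      using that z w p \<open>z \<in> pmn n\<close> by (auto simp: inversions_def pairs_def)
    moreover have "w z \<noteq> c" "w z \<noteq> a" using z w by auto
    ultimately have "(w z, c) \<in> inversions n w \<or> (a, w z) \<in> inversions n w" using p(3) by linarith
    then show False using least[of "w z" c] least[of a "w z"] z w by auto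
  qed
  moreover have "inv w c \<in> pmn n" "inv w a \<in> pmn n" using p inv_Bn[OF w] by auto
  ultimately obtain i where i: "i < n" "(inv w c = prev_pos i \<and> inv w a = int i + 1) \<or>
      (inv w c = - int i - 1 \<and> inv w a = - prev_pos i)"
    using adjacent_positions[of "inv w c" n "inv w a"] p(4) by metis
  have "w (- int i - 1) = - w (int i + 1)" "w (- prev_pos i) = - w (prev_pos i)"
    using Bn_D(3)[OF w, of "int i + 1"] Bn_D(3)[OF w] by auto
  moreover have "w (inv w c) = c" "w (inv w a) = a" using w by auto
  ultimately have "w (int i + 1) < w (prev_pos i)" using i(2) p(3) by auto
  then show ?thesis using that i(1) by blast
qed

text \<open>Sorting by descents: undoing one shrinks the inversion set. Hence the
  \<open>LEAST\<close> in \<open>len\<close> ranges over a nonempty set.\<close>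

lemma Bn_word:
  assumes "w \<in> Bn n"
  shows "\<exists>ws. is_word n ws \<and> word_prod ws = w"
  using assms
proof (induction "card (inversions n w)" arbitrary: w rule: less_induct)
  case less
  show ?case
  proof (cases "inversions n w = {}")
    case True
    then show ?thesis using inversions_empty[OF less.prems]
      by (intro exI[of _ "[]"]) auto
  next
    case False
    then obtain i where i: "i < n" "w (int i + 1) < w (prev_pos i)"
      using inversions_adjacent[OF less.prems] by metis
    have "inversions n (w \<circ> gen i) \<subset> inversions n w"
      using inversions_comp_gen_desc[OF less.prems i] by blast
    then have "card (inversions n (w \<circ> gen i)) < card (inversions n w)"
      by (simp add: finite_inversions psubset_card_mono)
    then obtain ws where "is_word n ws" "word_prod ws = w \<circ> gen i"
      using less.hyps comp_Bn[OF less.prems gen_Bn[OF i(1)]] by blast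
    then show ?thesis using i(1)
      by (intro exI[of _ "ws @ [i]"]) (auto simp: word_prod_append fun_eq_iff)
  qed
qed

lemma len_le: "is_word n ws \<Longrightarrow> len n (word_prod ws) \<le> length ws"
  unfolding len_def by (rule Least_le) blast

lemma len_word:
  assumes "w \<in> Bn n"
  obtains ws where "is_word n ws" "word_prod ws = w" "length ws = len n w"
proof -
  have "\<exists>k ws. is_word n ws \<and> length ws = k \<and> word_prod ws = w"
    using Bn_word[OF assms] by blast
  then have "\<exists>ws. is_word n ws \<and> length ws = len n w \<and> word_prod ws = w"
    unfolding len_def by (rule LeastI_ex)
  then show ?thesis using that by blast
qed

text \<open>For \<open>c = - a\<close> the two transpositions would cancel, hence the separate
  case.\<close>

definition refl_pair :: "int \<Rightarrow> int \<Rightarrow> int \<Rightarrow> int" where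
  "refl_pair a c = (if c = - a then Transposition.transpose a c
     else Transposition.transpose a c \<circ> Transposition.transpose (- a) (- c))"

lemma refl_pair_apply:
  assumes "a \<noteq> 0" "c \<noteq> 0"
  shows "refl_pair a c a = c" "refl_pair a c c = a"
  using assms
  by (auto simp: refl_pair_def Transposition.transpose_def)

lemma refl_pair_invol:
  assumes "a \<noteq> 0" "c \<noteq> 0"
  shows "refl_pair a c (refl_pair a c x) = x"
  using assms
  by (auto simp: refl_pair_def Transposition.transpose_def)

lemma refl_pair_sym:
  assumes "a \<noteq> 0" "c \<noteq> 0"
  shows "refl_pair a c = refl_pair c a" "refl_pair (- a) (- c) = refl_pair a c"
  using assms
  by (auto simp: refl_pair_def Transposition.transpose_def fun_eq_iff)

text \<open>Conjugation turns a swap of positions into the swap of the values standing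
  there.\<close>

lemma gen_conj:
  assumes w: "w \<in> Bn n"
  shows "w \<circ> gen i \<circ> inv w = refl_pair (w (prev_pos i)) (w (int i + 1))"
proof
  fix x
  obtain y where x: "x = w y" using Bn_f_inv[OF w] by metis
  have m: "w (- int i - 1) = - w (int i + 1)" "w (- prev_pos i) = - w (prev_pos i)" "- w k = w (- k)" for k
    using Bn_D(3)[OF w, of "int i + 1"] Bn_D(3)[OF w] by auto
  show "(w \<circ> gen i \<circ> inv w) x = refl_pair (w (prev_pos i)) (w (int i + 1)) x"
    unfolding x refl_pair_def m(3) using w
    by (auto simp: gen_def prev_pos_def Transposition.transpose_def Bn_eq_iff[OF w] Bn_inv_f)
qed

lemma reflections_are_pairs:
  assumes "t \<in> refls n"
  obtains a c where "(a, c) \<in> pairs n" "t = refl_pair a c" "t \<in> Bn n"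
proof -
  obtain w i where t: "t = w \<circ> gen i \<circ> inv w" "w \<in> Bn n" "i < n"
    using assms by (auto simp: refls_def)
  have "w (prev_pos i) \<noteq> w (int i + 1)"
    using prev_pos_less[of i] Bn_eq_iff[OF t(2)] by auto
  moreover have "w (prev_pos i) \<in> pmn n" "w (int i + 1) \<in> pmn n"
    using t prev_pos_in by auto
  ultimately have "(w (prev_pos i), w (int i + 1)) \<in> pairs n \<or> (w (int i + 1), w (prev_pos i)) \<in> pairs n"
    by (auto simp: pairs_def)
  moreover have "t \<in> Bn n" unfolding t(1)
    by (intro comp_Bn inv_Bn gen_Bn t)
  moreover have "w (prev_pos i) \<noteq> 0" "w (int i + 1) \<noteq> 0"
    using t(2,3) prev_pos_in[of i n] by (metis Bn_in zero_notin_pmn)+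
  ultimately show ?thesis using gen_conj[OF t(2), of i] t(1) refl_pair_sym(1) that by metis
qed

text \<open>Deletion: along a word, the pair is first inverted at some letter, and the reflection of
  the pair removes that letter.\<close>

lemma inversion_letter:
  assumes "is_word n ws" "u \<in> Bn n" "(a, c) \<in> inversions n (u \<circ> word_prod ws)" "(a, c) \<notin> inversions n u"
  shows "\<exists>us i vs. ws = us @ i # vs \<and>
    refl_pair a c = (u \<circ> word_prod us) \<circ> gen i \<circ> inv (u \<circ> word_prod us)"
  using assms
proof (induction ws arbitrary: u)
  case Nil
  then show ?case by simp
next
  case (Cons i ws)
  have i: "i < n" using Cons.prems(1) by simp
  show ?case
  proof (cases "(a, c) \<in> inversions n (u \<circ> gen i)")
    case False
    have "(a, c) \<in> inversions n ((u \<circ> gen i) \<circ> word_prod ws)"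
      using Cons.prems(3) by (metis comp_assoc word_prod_simps(2))
    then obtain us j vs where "ws = us @ j # vs"
      "refl_pair a c = (u \<circ> gen i \<circ> word_prod us) \<circ> gen j \<circ> inv (u \<circ> gen i \<circ> word_prod us)"
      using Cons.IH[OF _ comp_Bn[OF Cons.prems(2) gen_Bn[OF i]] _ False] Cons.prems(1)
      unfolding is_word_simps by blast
    moreover have "u \<circ> gen i \<circ> word_prod us = u \<circ> word_prod (i # us)"
      by (simp only: word_prod_simps comp_assoc)
    ultimately have "i # ws = (i # us) @ j # vs \<and>
        refl_pair a c = (u \<circ> word_prod (i # us)) \<circ> gen j \<circ> inv (u \<circ> word_prod (i # us))"
      by simp
    then show ?thesis by blast
  next
    case True
    have ne: "u (prev_pos i) \<noteq> u (int i + 1)"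
      using prev_pos_less[of i] Bn_eq_iff[OF Cons.prems(2)] by auto
    \<comment> \<open>The letter affects only these two pairs, and at a descent it only removes
      them, so the new inversion is one of them.\<close>
    have "(a, c) \<in> {(u (prev_pos i), u (int i + 1)), (- u (int i + 1), - u (prev_pos i))}"
    proof (cases "u (prev_pos i) < u (int i + 1)")
      case asc: True
      then show ?thesis using inversions_comp_gen[OF Cons.prems(2) i asc] True Cons.prems(4) by auto
    next
      case False
      then show ?thesis
        using inversions_comp_gen_desc(1)[OF Cons.prems(2) i] ne True Cons.prems(4) by auto
    qed
    moreover have "u (prev_pos i) \<noteq> 0" "u (int i + 1) \<noteq> 0"
      using Cons.prems(2) i prev_pos_in[of i n] by (metis Bn_in zero_notin_pmn)+
    ultimately have "refl_pair a c = refl_pair (u (prev_pos i)) (u (int i + 1))"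
      using refl_pair_sym by (metis insertE prod.inject singletonD neg_equal_0_iff_equal)
    then have "refl_pair a c = u \<circ> gen i \<circ> inv u"
      unfolding gen_conj[OF Cons.prems(2)] .
    then show ?thesis by (intro exI[of _ "[]"] exI[of _ i] exI[of _ ws]) simp
  qed
qed

text \<open>Deleting the letter from a shortest word for \<open>w\<close> leaves a shorter word for
  the product with the reflection.\<close>

lemma inversion_reflection:
  assumes w: "w \<in> Bn n" and ac: "(a, c) \<in> inversions n w"
  shows "refl_pair a c \<in> refls n" "len n (refl_pair a c \<circ> w) < len n w"
proof -
  obtain ws where ws: "is_word n ws" "word_prod ws = w" "length ws = len n w"
    using len_word[OF w] by blast
  obtain us i vs where s: "ws = us @ i # vs"
    "refl_pair a c = word_prod us \<circ> gen i \<circ> inv (word_prod us)"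
    using inversion_letter[OF ws(1) id_Bn, of a c] ac ws(2) by (auto simp: inversions_id)
  have us: "word_prod us \<in> Bn n" "i < n" using ws(1) s(1) by (auto intro: word_prod_Bn)
  then show "refl_pair a c \<in> refls n" using s(2) by (auto simp: refls_def)
  have "refl_pair a c \<circ> w = word_prod (us @ vs)"
    using us by (auto simp: s(2) ws(2)[symmetric] s(1) word_prod_append fun_eq_iff)
  moreover have "is_word n (us @ vs)" using ws(1) s(1) by simp
  ultimately show "len n (refl_pair a c \<circ> w) < len n w"
    using len_le[of n "us @ vs"] ws(3) s(1) by simp
qed

text \<open>If \<open>w\<close> does not invert the pair, then
  \<open>refl_pair a c \<circ> w\<close> does. Multiplying by the reflection once more gives back
  \<open>w\<close>, so \<open>w\<close> is the shorter of the two.\<close>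

lemma inv_set_iff:
  assumes w: "w \<in> Bn n" and ac: "(a, c) \<in> pairs n" and t: "refl_pair a c \<in> refls n"
  shows "refl_pair a c \<in> inv_set n w \<longleftrightarrow> (a, c) \<in> inversions n w"
proof
  assume "(a, c) \<in> inversions n w"
  then show "refl_pair a c \<in> inv_set n w"
    using inversion_reflection[OF w] by (simp add: inv_set_def)
next
  assume asm: "refl_pair a c \<in> inv_set n w"
  show "(a, c) \<in> inversions n w"
  proof (rule ccontr)
    assume no: "(a, c) \<notin> inversions n w"
    have tB: "refl_pair a c \<in> Bn n" using reflections_are_pairs[OF t] by blast
    have nz: "a \<noteq> 0" "c \<noteq> 0" using ac by (auto simp: pairs_def)
    have it: "inv (refl_pair a c) = refl_pair a c"
      by (rule inv_unique_comp) (auto simp: fun_eq_iff refl_pair_invol[OF nz])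
    have "inv w a \<noteq> inv w c" using ac w by (metis (no_types, lifting) Bn_f_inv case_prodD less_irrefl mem_Collect_eq pairs_def)
    then have "(a, c) \<in> inversions n (refl_pair a c \<circ> w)"
      using no ac by (auto simp: inversions_def inv_comp_Bn[OF tB w] it refl_pair_apply[OF nz])
    then have "len n (refl_pair a c \<circ> (refl_pair a c \<circ> w)) < len n (refl_pair a c \<circ> w)"
      by (rule inversion_reflection(2)[OF comp_Bn[OF tB w]])
    moreover have "refl_pair a c \<circ> (refl_pair a c \<circ> w) = w"
      by (auto simp: fun_eq_iff refl_pair_invol[OF nz])
    ultimately show False using asm by (simp add: inv_set_def)
  qed
qed

lemma weak_le_iff:
  assumes v: "v \<in> Bn n" and w: "w \<in> Bn n"
  shows "weak_le n v w \<longleftrightarrow> inversions n v \<subseteq> inversions n w"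
proof
  assume le: "weak_le n v w"
  show "inversions n v \<subseteq> inversions n w"
  proof clarify
    fix a c assume ac: "(a, c) \<in> inversions n v"
    then have p: "(a, c) \<in> pairs n" and t: "refl_pair a c \<in> refls n"
      using inversion_reflection(1)[OF v ac] by (auto simp: inversions_def)
    then show "(a, c) \<in> inversions n w"
      using le ac inv_set_iff[OF v p t] inv_set_iff[OF w p t] by (auto simp: weak_le_def)
  qed
next
  assume sub: "inversions n v \<subseteq> inversions n w"
  show "weak_le n v w"
    unfolding weak_le_def
  proof
    fix t assume t: "t \<in> inv_set n v"
    then have "t \<in> refls n" by (simp add: inv_set_def)
    then obtain a c where "(a, c) \<in> pairs n" "t = refl_pair a c" using reflections_are_pairs by blast
    then show "t \<in> inv_set n w"
      using inv_set_iff[OF v] inv_set_iff[OF w] t sub \<open>t \<in> refls n\<close> by blast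
  qed
qed

section \<open>Biclosed sets\<close>

text \<open>The last clause is transitivity of the complement, stated positively; complementation
  exchanges it with the clause before.\<close>

definition biclosed :: "nat \<Rightarrow> (int \<times> int) set \<Rightarrow> bool" where
  "biclosed n S \<longleftrightarrow> S \<subseteq> pairs n \<and> (\<forall>a c. (a, c) \<in> S \<longrightarrow> (- c, - a) \<in> S) \<and>
     (\<forall>a b c. (a, b) \<in> S \<longrightarrow> (b, c) \<in> S \<longrightarrow> (a, c) \<in> S) \<and>
     (\<forall>a b c. (a, c) \<in> S \<longrightarrow> b \<in> pmn n \<longrightarrow> a < b \<longrightarrow> b < c \<longrightarrow> (a, b) \<in> S \<or> (b, c) \<in> S)"

lemma biclosedI:
  assumes "\<And>a c. (a, c) \<in> S \<Longrightarrow> (a, c) \<in> pairs n"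
    and "\<And>a c. (a, c) \<in> S \<Longrightarrow> (- c, - a) \<in> S"
    and "\<And>a b c. (a, b) \<in> S \<Longrightarrow> (b, c) \<in> S \<Longrightarrow> (a, c) \<in> S"
    and "\<And>a b c. (a, c) \<in> S \<Longrightarrow> b \<in> pmn n \<Longrightarrow> a < b \<Longrightarrow> b < c \<Longrightarrow> (a, b) \<in> S \<or> (b, c) \<in> S"
  shows "biclosed n S"
  unfolding biclosed_def using assms by (intro conjI subrelI allI impI) blast+

lemma biclosedD:
  assumes "biclosed n S"
  shows "S \<subseteq> pairs n"
    and "(a, c) \<in> S \<Longrightarrow> a \<in> pmn n \<and> c \<in> pmn n \<and> a < c"
    and "(a, c) \<in> S \<Longrightarrow> (- c, - a) \<in> S"
    and "(a, b) \<in> S \<Longrightarrow> (b, c) \<in> S \<Longrightarrow> (a, c) \<in> S"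
    and "(a, c) \<in> S \<Longrightarrow> b \<in> pmn n \<Longrightarrow> a < b \<Longrightarrow> b < c \<Longrightarrow> (a, b) \<in> S \<or> (b, c) \<in> S"
proof -
  show S: "S \<subseteq> pairs n" using assms by (simp add: biclosed_def)
  show "(a, c) \<in> S \<Longrightarrow> a \<in> pmn n \<and> c \<in> pmn n \<and> a < c" using S by (auto simp: pairs_def)
qed (use assms in \<open>unfold biclosed_def, blast+\<close>)

lemma pairs_iff [simp]: "(a, c) \<in> pairs n \<longleftrightarrow> a \<in> pmn n \<and> c \<in> pmn n \<and> a < c"
  by (simp add: pairs_def)

lemma biclosed_inversions:
  assumes w: "w \<in> Bn n"
  shows "biclosed n (inversions n w)"
proof (rule biclosedI)
  fix a b c assume "(a, c) \<in> inversions n w" "b \<in> pmn n" "a < b" "b < c"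
  then show "(a, b) \<in> inversions n w \<or> (b, c) \<in> inversions n w"
    by (cases "inv w b < inv w a") (auto simp: inversions_def)
qed (auto simp: inversions_def inv_Bn_uminus[OF w])

lemma biclosed_compl:
  assumes "biclosed n S"
  shows "biclosed n (pairs n - S)"
proof (rule biclosedI)
  note D = biclosedD[OF assms]
  fix a c assume "(a, c) \<in> pairs n - S"
  then show "(- c, - a) \<in> pairs n - S" using D(3)[of "- c" "- a"] by auto
next
  note D = biclosedD[OF assms]
  fix a b c assume "(a, b) \<in> pairs n - S" "(b, c) \<in> pairs n - S"
  then show "(a, c) \<in> pairs n - S" using D(5)[of a c b] by auto
next
  note D = biclosedD[OF assms]
  fix a b c assume "(a, c) \<in> pairs n - S" "b \<in> pmn n" "a < b" "b < c"
  then show "(a, b) \<in> pairs n - S \<or> (b, c) \<in> pairs n - S" using D(4)[of a b c] by auto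
qed auto

lemma finite_biclosed: "biclosed n S \<Longrightarrow> finite S"
  using biclosedD(1) finite_pairs finite_subset by blast

text \<open>A maximal \<open>w\<close> with inversions inside \<open>S\<close> realises \<open>S\<close>: a missing pair at minimal
  distance in \<open>w\<close> is adjacent, so swapping it enlarges the inversion set.\<close>

lemma biclosed_realisable:
  assumes S: "biclosed n S"
  shows "\<exists>w\<in>Bn n. inversions n w = S"
proof -
  note D = biclosedD[OF S]
  have "\<exists>w. (w \<in> Bn n \<and> inversions n w \<subseteq> S) \<and>
      (\<forall>v. (v \<in> Bn n \<and> inversions n v \<subseteq> S) \<longrightarrow> card (inversions n v) \<le> card (inversions n w))"
  proof (rule ex_has_greatest_nat)
    show "id \<in> Bn n \<and> inversions n id \<subseteq> S" by (auto simp: id_Bn inversions_def)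
    \<comment> \<open>\<open>Suc\<close> because the maximum principle asks for a strict
      bound.\<close>
    show "\<forall>v. v \<in> Bn n \<and> inversions n v \<subseteq> S \<longrightarrow> card (inversions n v) < Suc (card (pairs n))"
      by (auto intro!: card_mono finite_pairs simp: inversions_def less_Suc_eq_le)
  qed
  then obtain w where w: "w \<in> Bn n" "inversions n w \<subseteq> S"
    and max: "\<And>v. v \<in> Bn n \<Longrightarrow> inversions n v \<subseteq> S \<Longrightarrow> card (inversions n v) \<le> card (inversions n w)"
    by blast
  have "S \<subseteq> inversions n w"
  proof (rule ccontr)
    assume "\<not> S \<subseteq> inversions n w"
    then obtain x0 where "x0 \<in> S - inversions n w" by blast
    from ex_has_least_nat[of "\<lambda>x. x \<in> S - inversions n w", OF this,
        of "\<lambda>x. nat (inv w (snd x) - inv w (fst x))"]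
    obtain x where x: "x \<in> S - inversions n w" "\<And>y. y \<in> S - inversions n w \<Longrightarrow>
        nat (inv w (snd x) - inv w (fst x)) \<le> nat (inv w (snd y) - inv w (fst y))"
      by blast
    obtain a c where xac: "x = (a, c)" by (metis surj_pair)
    have least: "nat (inv w c - inv w a) \<le> nat (inv w c' - inv w a')"
      if "(a', c') \<in> S" "(a', c') \<notin> inversions n w" for a' c'
      using x(2)[of "(a', c')"] that xac by simp
    have ac: "(a, c) \<in> S" "(a, c) \<notin> inversions n w" using x(1) xac by auto
    have acp: "a \<in> pmn n" "c \<in> pmn n" "a < c" using D(2)[OF ac(1)] by auto
    have inj: "inv w x = inv w y \<longleftrightarrow> x = y" for x y using w(1) by (metis Bn_f_inv)
    have "inv w a \<noteq> inv w c" using acp(3) inj by auto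
    then have pos: "inv w a < inv w c" using ac(2) acp by (auto simp: inversions_def)
    have adj: "\<not> (inv w a < inv w e \<and> inv w e < inv w c)" if e: "e \<in> pmn n" for e
    proof
      assume b: "inv w a < inv w e \<and> inv w e < inv w c"
      \<comment> \<open>If \<open>e\<close> is below or above both values, an inversion of
        \<open>w\<close> lies in \<open>S\<close> and transitivity applies; if it is between them,
        the last clause of \<open>biclosed\<close> does.\<close>
      have "(a, e) \<in> S \<and> (a, e) \<notin> inversions n w \<or> (e, c) \<in> S \<and> (e, c) \<notin> inversions n w"
      proof -
        consider "e < a" | "a < e" "e < c" | "c < e" using b inj by fastforce
        then show ?thesis
        proof cases
          case 1
          then have "(e, a) \<in> S" using w(2) b e acp by (auto simp: inversions_def)
          then have "(e, c) \<in> S" using D(4) ac(1) by blast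
          then show ?thesis using b by (auto simp: inversions_def)
        next
          case 2
          then show ?thesis using D(5)[OF ac(1) e] b by (auto simp: inversions_def)
        next
          case 3
          then have "(c, e) \<in> S" using w(2) b e acp by (auto simp: inversions_def)
          then have "(a, e) \<in> S" using D(4) ac(1) by blast
          then show ?thesis using b by (auto simp: inversions_def)
        qed
      qed
      then show False using least[of a e] least[of e c] b by auto
    qed
    obtain i where i: "i < n" "inversions n (w \<circ> gen i) = inversions n w \<union> {(a, c), (- c, - a)}"
      using adjacent_swap[OF w(1) _ pos adj] acp by auto
    have "inversions n (w \<circ> gen i) \<subseteq> S" using i(2) w(2) ac(1) D(3) by auto
    moreover have "inversions n w \<subset> inversions n (w \<circ> gen i)" using i(2) ac(2) by auto
    then have "card (inversions n w) < card (inversions n (w \<circ> gen i))"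
      by (intro psubset_card_mono finite_biclosed[of n]) (auto intro!: biclosed_inversions comp_Bn gen_Bn w i)
    ultimately show False using max[OF comp_Bn[OF w(1) gen_Bn[OF i(1)]]] by simp
  qed
  then show ?thesis using w by blast
qed

text \<open>An odd injective position function is all that the later arguments need to know of the
  permutation.\<close>

lemma biclosed_positions:
  assumes "biclosed n S"
  obtains p :: "int \<Rightarrow> int" where "inj p" "\<And>x. p (- x) = - p x" "S = {(a, c) \<in> pairs n. p c < p a}"
proof -
  obtain w where w: "w \<in> Bn n" "inversions n w = S" using biclosed_realisable[OF assms] by blast
  show ?thesis
  proof (rule that[of "inv w"])
    show "inj (inv w)" using w by (metis Bn_f_inv injI)
    show "inv w (- x) = - inv w x" for x by (rule inv_Bn_uminus[OF w(1)])
    show "S = {(a, c) \<in> pairs n. inv w c < inv w a}" using w(2) by (simp add: inversions_def)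
  qed
qed

abbreviation biclosed_sets :: "nat \<Rightarrow> (int \<times> int) set set" where
  "biclosed_sets n \<equiv> {S. biclosed n S}"

text \<open>The join is the transitive closure of the union. For the last clause of
  \<open>biclosed\<close>, \<open>b\<close> is compared with the last intermediate point of a
  chain.\<close>

lemma biclosed_join:
  assumes A: "biclosed n A" and B: "biclosed n B"
  obtains J where "is_join (biclosed_sets n) (\<subseteq>) A B J"
proof -
  note DA = biclosedD[OF A] and DB = biclosedD[OF B]
  let ?J = "(A \<union> B)\<^sup>+"
  have "biclosed n ?J"
  proof (rule biclosedI)
    fix a c assume "(a, c) \<in> ?J"
    then show "(a, c) \<in> pairs n"
    proof induction
      case (base c) then show ?case using DA(2) DB(2) by auto
    next
      case (step b c)
      then show ?case using DA(2)[of b c] DB(2)[of b c] by auto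
    qed
  next
    fix a c assume "(a, c) \<in> ?J"
    then show "(- c, - a) \<in> ?J"
    proof induction
      case (base c) then show ?case using DA(3) DB(3) by (metis Un_iff r_into_trancl')
    next
      case (step b c)
      then have "(- c, - b) \<in> A \<union> B" using DA(3) DB(3) by blast
      then show ?case using step.IH by (meson r_into_trancl' trancl_trans)
    qed
  next
    fix a b c assume "(a, c) \<in> ?J" "b \<in> pmn n" "a < b" "b < c"
    then show "(a, b) \<in> ?J \<or> (b, c) \<in> ?J"
    proof induction
      case (base c)
      then show ?case using DA(5)[of a c b] DB(5)[of a c b] by auto
    next
      case (step d c)
      consider "b < d" | "b = d" | "d < b" by linarith
      then show ?case
      proof cases
        case 1 then show ?thesis using step by (meson trancl.simps)
      next
        case 2 then show ?thesis using step by auto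
      next
        case 3
        then have "(d, b) \<in> A \<union> B \<or> (b, c) \<in> A \<union> B"
          using step DA(5)[of d c b] DB(5)[of d c b] by auto
        then show ?thesis using step by (meson r_into_trancl' trancl.simps)
      qed
    qed
  qed auto
  moreover have "?J \<subseteq> S" if "biclosed n S" "A \<subseteq> S" "B \<subseteq> S" for S
  proof -
    have "trans S" using biclosedD(4)[OF that(1)] by (blast intro: transI)
    then show ?thesis using that by (metis Un_least trancl_id trancl_mono_subset)
  qed
  ultimately have "is_join (biclosed_sets n) (\<subseteq>) A B ?J" by (auto simp: is_join_def)
  then show ?thesis by (rule that)
qed

section \<open>The projections onto bottom and top elements\<close>

text \<open>Unfolding the closure condition: \<open>(a, c)\<close> lies in the largest part of \<open>S\<close> closed under
  \<open>(a, c) \<mapsto> (b, c)\<close> for up \<open>b\<close> and \<open>(a, c) \<mapsto> (a, b)\<close> for down \<open>b\<close> iff all pairs reachable from it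
  are in \<open>S\<close>.\<close>

definition pi_down :: "nat \<Rightarrow> (int \<Rightarrow> bool) \<Rightarrow> (int \<times> int) set \<Rightarrow> (int \<times> int) set" where
  "pi_down n u S = {(a, c) \<in> pairs n. \<forall>a'\<in>pmn n. \<forall>c'\<in>pmn n.
     a \<le> a' \<longrightarrow> a' < c' \<longrightarrow> c' \<le> c \<longrightarrow> a' = a \<or> u a' \<longrightarrow> c' = c \<or> \<not> u c' \<longrightarrow> (a', c') \<in> S}"

text \<open>Complementation reverses inclusion and exchanges up and down, so this gives the top of a
  fibre as \<open>pi_down\<close> gives the bottom.\<close>

definition pi_up :: "nat \<Rightarrow> (int \<Rightarrow> bool) \<Rightarrow> (int \<times> int) set \<Rightarrow> (int \<times> int) set" where
  "pi_up n u S = pairs n - pi_down n (\<lambda>x. \<not> u x) (pairs n - S)"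

text \<open>The sign rule for negative indices; it makes \<open>pi_down\<close> respect the symmetry
  that sends \<open>(a, c)\<close> to \<open>(- c, - a)\<close>.\<close>

definition odd_pred :: "nat \<Rightarrow> (int \<Rightarrow> bool) \<Rightarrow> bool" where
  "odd_pred n u \<longleftrightarrow> (\<forall>x\<in>pmn n. u (- x) = (\<not> u x))"

lemma pi_downI:
  assumes "a \<in> pmn n" "c \<in> pmn n" "a < c"
    and "\<And>a' c'. a' \<in> pmn n \<Longrightarrow> c' \<in> pmn n \<Longrightarrow> a \<le> a' \<Longrightarrow> a' < c' \<Longrightarrow> c' \<le> c \<Longrightarrow>
      a' = a \<or> u a' \<Longrightarrow> c' = c \<or> \<not> u c' \<Longrightarrow> (a', c') \<in> S"
  shows "(a, c) \<in> pi_down n u S"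
  using assms by (simp add: pi_down_def)

lemma pi_downD:
  assumes "(a, c) \<in> pi_down n u S"
  shows "a \<in> pmn n" "c \<in> pmn n" "a < c"
    and "a' \<in> pmn n \<Longrightarrow> c' \<in> pmn n \<Longrightarrow> a \<le> a' \<Longrightarrow> a' < c' \<Longrightarrow> c' \<le> c \<Longrightarrow>
      a' = a \<or> u a' \<Longrightarrow> c' = c \<or> \<not> u c' \<Longrightarrow> (a', c') \<in> S"
  using assms by (auto simp: pi_down_def)

lemma pi_down_subset: "pi_down n u S \<subseteq> S"
proof (rule subrelI)
  fix a c assume "(a, c) \<in> pi_down n u S"
  from pi_downD(1-3)[OF this] pi_downD(4)[OF this, of a c] show "(a, c) \<in> S" by simp
qed

lemma pi_down_pairs: "pi_down n u S \<subseteq> pairs n"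
  by (auto simp: pi_down_def)

lemma pi_down_mono: "S \<subseteq> T \<Longrightarrow> pi_down n u S \<subseteq> pi_down n u T"
  by (auto simp: pi_down_def)

lemma pi_down_up:
  assumes "(a, c) \<in> pi_down n u S" "b \<in> pmn n" "a < b" "b < c" "u b"
  shows "(b, c) \<in> pi_down n u S"
  using assms pi_downD(2)[OF assms(1)] by (intro pi_downI) (auto intro: pi_downD(4)[OF assms(1)])

lemma pi_down_down:
  assumes "(a, c) \<in> pi_down n u S" "b \<in> pmn n" "a < b" "b < c" "\<not> u b"
  shows "(a, b) \<in> pi_down n u S"
  using assms pi_downD(1)[OF assms(1)] by (intro pi_downI) (auto intro: pi_downD(4)[OF assms(1)])

lemma pi_down_greatest:
  assumes "T \<subseteq> S" "T \<subseteq> pairs n"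
    and up: "\<And>a b c. (a, c) \<in> T \<Longrightarrow> b \<in> pmn n \<Longrightarrow> a < b \<Longrightarrow> b < c \<Longrightarrow> u b \<Longrightarrow> (b, c) \<in> T"
    and down: "\<And>a b c. (a, c) \<in> T \<Longrightarrow> b \<in> pmn n \<Longrightarrow> a < b \<Longrightarrow> b < c \<Longrightarrow> \<not> u b \<Longrightarrow> (a, b) \<in> T"
  shows "T \<subseteq> pi_down n u S"
proof clarify
  fix a c assume ac: "(a, c) \<in> T"
  show "(a, c) \<in> pi_down n u S"
  proof (rule pi_downI)
    fix a' c' assume h: "a' \<in> pmn n" "c' \<in> pmn n" "a \<le> a'" "a' < c'" "c' \<le> c"
      "a' = a \<or> u a'" "c' = c \<or> \<not> u c'"
    \<comment> \<open>Two moves reach any such pair: raise the left end to an up value, then lower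
      the right end to a down value.\<close>
    have "(a', c) \<in> T" using up[OF ac, of a'] ac h by (cases "a' = a") auto
    then have "(a', c') \<in> T" using down[of a' c c'] h by (cases "c' = c") auto
    then show "(a', c') \<in> S" using assms(1) by blast
  qed (use ac assms(2) in auto)
qed

lemma pi_down_idem: "pi_down n u (pi_down n u S) = pi_down n u S"
proof
  show "pi_down n u S \<subseteq> pi_down n u (pi_down n u S)"
    by (rule pi_down_greatest)
      (rule subset_refl, rule pi_down_pairs, erule (4) pi_down_up, erule (4) pi_down_down)
qed (rule pi_down_subset)

text \<open>For transitivity, a reachable pair straddling \<open>b\<close> is split at
  \<open>b\<close>. For the last clause, an up \<open>b\<close> gives \<open>(b, c)\<close> and a
  down \<open>b\<close> gives \<open>(a, b)\<close>.\<close>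

lemma biclosed_pi_down:
  assumes S: "biclosed n S" and u: "odd_pred n u"
  shows "biclosed n (pi_down n u S)"
proof (rule biclosedI)
  note D = biclosedD[OF S]
  fix a c assume ac: "(a, c) \<in> pi_down n u S"
  show "(a, c) \<in> pairs n" using pi_downD[OF ac] by simp
  show "(- c, - a) \<in> pi_down n u S"
  proof (rule pi_downI)
    fix a' c' assume h: "a' \<in> pmn n" "c' \<in> pmn n" "- c \<le> a'" "a' < c'" "c' \<le> - a"
      "a' = - c \<or> u a'" "c' = - a \<or> \<not> u c'"
    have "u (- c') = (\<not> u c')" "u (- a') = (\<not> u a')" using u h(1,2) by (auto simp: odd_pred_def)
    then have "(- c', - a') \<in> S"
      using h by (intro pi_downD(4)[OF ac]) (simp_all, linarith+)
    then show "(a', c') \<in> S" using D(3)[of "- c'" "- a'"] by simp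
  qed (use pi_downD[OF ac] in auto)
next
  note D = biclosedD[OF S]
  fix a b c assume ab: "(a, b) \<in> pi_down n u S" and bc: "(b, c) \<in> pi_down n u S"
  show "(a, c) \<in> pi_down n u S"
  proof (rule pi_downI)
    fix a' c' assume h: "a' \<in> pmn n" "c' \<in> pmn n" "a \<le> a'" "a' < c'" "c' \<le> c"
      "a' = a \<or> u a'" "c' = c \<or> \<not> u c'"
    consider "c' \<le> b" | "b \<le> a'" | "a' < b" "b < c'" by linarith
    then show "(a', c') \<in> S"
    proof cases
      case 1
      then show ?thesis using pi_downD(4)[OF ab h(1,2)] h pi_downD(3)[OF bc] by auto
    next
      case 2
      then show ?thesis using pi_downD(4)[OF bc h(1,2)] h pi_downD(3)[OF ab] by auto
    next
      case 3
      then have "(a', b) \<in> S" "(b, c') \<in> S"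
        using pi_downD(4)[OF ab h(1), of b] pi_downD(4)[OF bc _ h(2), of b] pi_downD(2)[OF ab] h by auto
      then show ?thesis using D(4) by blast
    qed
  qed (use pi_downD[OF ab] pi_downD[OF bc] in auto)
next
  fix a b c assume "(a, c) \<in> pi_down n u S" "b \<in> pmn n" "a < b" "b < c"
  then show "(a, b) \<in> pi_down n u S \<or> (b, c) \<in> pi_down n u S"
    using pi_down_up[of a c n u S b] pi_down_down[of a c n u S b] by blast
qed

lemma biclosed_pi_up:
  assumes "biclosed n S" "odd_pred n u"
  shows "biclosed n (pi_up n u S)"
  unfolding pi_up_def by (intro biclosed_compl biclosed_pi_down assms) (use assms(2) in \<open>simp add: odd_pred_def\<close>)

lemma pi_up_superset: "S \<subseteq> pairs n \<Longrightarrow> S \<subseteq> pi_up n u S"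
  using pi_down_subset[of n "\<lambda>x. \<not> u x" "pairs n - S"] by (auto simp: pi_up_def)

lemma pi_up_mono: "S \<subseteq> T \<Longrightarrow> pi_up n u S \<subseteq> pi_up n u T"
  using pi_down_mono[of "pairs n - T" "pairs n - S" n "\<lambda>x. \<not> u x"] by (auto simp: pi_up_def)

text \<open>By induction on \<open>c - a\<close>: as \<open>(a, c) \<in> pi_up n u S\<close>, some \<open>(a', c')\<close> inside \<open>[a, c]\<close> lies in
  \<open>S\<close>, with \<open>c' = c\<close> or \<open>c'\<close> up and \<open>a' = a\<close> or \<open>a'\<close> down. The induction hypothesis puts \<open>(c', c)\<close> and
  \<open>(a, a')\<close> in \<open>S\<close>, hence \<open>(a, c)\<close> by transitivity.\<close>

lemma pi_down_pi_up:
  assumes S: "biclosed n S"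
  shows "pi_down n u (pi_up n u S) = pi_down n u S"
proof
  note D = biclosedD[OF S]
  have key: "(a, c) \<in> pi_down n u (pi_up n u S) \<Longrightarrow> (a, c) \<in> S" for a c
  proof (induction "nat (c - a)" arbitrary: a c rule: less_induct)
    case less
    note ac = pi_downD(1-3)[OF less.prems]
    have "(a, c) \<in> pi_up n u S" by (rule subsetD[OF pi_down_subset less.prems])
    then have "(a, c) \<notin> pi_down n (\<lambda>x. \<not> u x) (pairs n - S)" by (simp add: pi_up_def)
    then have "\<not> (\<forall>a' c'. a' \<in> pmn n \<longrightarrow> c' \<in> pmn n \<longrightarrow> a \<le> a' \<longrightarrow> a' < c' \<longrightarrow> c' \<le> c \<longrightarrow>
        a' = a \<or> \<not> u a' \<longrightarrow> c' = c \<or> u c' \<longrightarrow> (a', c') \<notin> S)"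
      using pi_downI[OF ac, of "\<lambda>x. \<not> u x" "pairs n - S"] by fastforce
    then obtain a' c' where h: "a' \<in> pmn n" "c' \<in> pmn n" "a \<le> a'" "a' < c'" "c' \<le> c"
      "a' = a \<or> \<not> u a'" "c' = c \<or> u c'" "(a', c') \<in> S"
      by blast
    have "(c', c) \<in> S" if "c' \<noteq> c"
      by (rule less.hyps[OF _ pi_down_up[OF less.prems h(2)]]) (use that h in auto)
    moreover have "(a, a') \<in> S" if "a' \<noteq> a"
      by (rule less.hyps[OF _ pi_down_down[OF less.prems h(1)]]) (use that h in auto)
    ultimately show ?case using h(8) D(4)[of a a' c'] D(4)[of a c' c] by blast
  qed
  show "pi_down n u (pi_up n u S) \<subseteq> pi_down n u S"
  proof (rule pi_down_greatest)
    show "pi_down n u (pi_up n u S) \<subseteq> S" by (rule subrelI) (rule key)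
    show "pi_down n u (pi_up n u S) \<subseteq> pairs n" by (rule pi_down_pairs)
  qed (erule (4) pi_down_up, erule (4) pi_down_down)
  show "pi_down n u S \<subseteq> pi_down n u (pi_up n u S)"
    by (rule pi_down_mono[OF pi_up_superset[OF D(1)]])
qed

text \<open>The preceding lemma for the complement, with up and down exchanged.\<close>

lemma pi_up_pi_down:
  assumes S: "biclosed n S"
  shows "pi_up n u (pi_down n u S) = pi_up n u S"
proof -
  have "pairs n - (pairs n - S) = S" using biclosedD(1)[OF S] by blast
  then have "pi_up n (\<lambda>x. \<not> u x) (pairs n - S) = pairs n - pi_down n u S" by (simp add: pi_up_def)
  then have "pi_down n (\<lambda>x. \<not> u x) (pairs n - pi_down n u S) = pi_down n (\<lambda>x. \<not> u x) (pairs n - S)"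
    using pi_down_pi_up[OF biclosed_compl[OF S], of "\<lambda>x. \<not> u x"] by argo
  then show ?thesis by (simp only: pi_up_def)
qed

section \<open>Fibres of the projections as congruence classes\<close>

definition pi_congruence :: "nat \<Rightarrow> (int \<Rightarrow> bool) \<Rightarrow> (int \<times> int) set rel" where
  "pi_congruence n u = {(A, B). biclosed n A \<and> biclosed n B \<and> pi_down n u A = pi_down n u B}"

lemma pi_up_cong:
  assumes "biclosed n A" "biclosed n B" "pi_down n u A = pi_down n u B"
  shows "pi_up n u A = pi_up n u B"
  using pi_up_pi_down[OF assms(1), of u] pi_up_pi_down[OF assms(2), of u] assms(3) by simp

lemma pi_down_cong:
  assumes "biclosed n A" "biclosed n B" "pi_up n u A = pi_up n u B"
  shows "pi_down n u A = pi_down n u B"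
  using pi_down_pi_up[OF assms(1), of u] pi_down_pi_up[OF assms(2), of u] assms(3) by simp

lemma pi_up_idem:
  assumes "biclosed n A" "odd_pred n u"
  shows "pi_up n u (pi_up n u A) = pi_up n u A"
  by (rule pi_up_cong[OF biclosed_pi_up[OF assms] assms(1) pi_down_pi_up[OF assms(1)]])

text \<open>Meets are compared through bottoms: the bottom of \<open>M\<close> lies below
  \<open>B\<close> and \<open>C\<close>, hence below \<open>M'\<close>. Joins are compared through
  tops: the top of \<open>M\<close> lies above \<open>B\<close> and \<open>C\<close>, hence above
  \<open>M'\<close>.\<close>

lemma lattice_congruence_pi:
  assumes u: "odd_pred n u"
  shows "lattice_congruence (biclosed_sets n) (\<subseteq>) (pi_congruence n u)"
proof -
  have meet: "pi_down n u M \<subseteq> pi_down n u M'"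
    if AB: "pi_down n u A = pi_down n u B" and M: "biclosed n M"
      and m: "is_meet (biclosed_sets n) (\<subseteq>) A C M" "is_meet (biclosed_sets n) (\<subseteq>) B C M'"
    for A B C M M'
  proof -
    have "M \<subseteq> A" "M \<subseteq> C" using m(1) unfolding is_meet_def by blast+
    then have "pi_down n u M \<subseteq> pi_down n u B" "pi_down n u M \<subseteq> C"
      using pi_down_mono[of M A n u] pi_down_subset[of n u M] AB by auto
    then have "pi_down n u M \<subseteq> B" "pi_down n u M \<subseteq> C" using pi_down_subset[of n u B] by blast+
    moreover have "pi_down n u M \<in> biclosed_sets n" using biclosed_pi_down[OF M u] by simp
    ultimately have "pi_down n u M \<subseteq> M'" using m(2) unfolding is_meet_def by blast
    from pi_down_mono[OF this, of n u] show ?thesis by (simp add: pi_down_idem)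
  qed
  have join: "pi_up n u M' \<subseteq> pi_up n u M"
    if AB: "pi_up n u A = pi_up n u B" and B: "biclosed n B" and M: "biclosed n M"
      and m: "is_join (biclosed_sets n) (\<subseteq>) A C M" "is_join (biclosed_sets n) (\<subseteq>) B C M'"
    for A B C M M'
  proof -
    have "A \<subseteq> M" "C \<subseteq> M" using m(1) unfolding is_join_def by blast+
    then have "pi_up n u B \<subseteq> pi_up n u M" "C \<subseteq> pi_up n u M"
      using pi_up_mono[of A M n u] pi_up_superset[OF biclosedD(1)[OF M], of u] AB by auto
    then have "B \<subseteq> pi_up n u M" "C \<subseteq> pi_up n u M"
      using pi_up_superset[OF biclosedD(1)[OF B], of u] by blast+
    moreover have "pi_up n u M \<in> biclosed_sets n" using biclosed_pi_up[OF M u] by simp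
    ultimately have "M' \<subseteq> pi_up n u M" using m(2) unfolding is_join_def by blast
    from pi_up_mono[OF this, of n u] show ?thesis by (simp only: pi_up_idem[OF M u])
  qed
  have "equiv (biclosed_sets n) (pi_congruence n u)"
    by (auto simp: equiv_def refl_on_def sym_def trans_def pi_congruence_def)
  moreover have "(M, M') \<in> pi_congruence n u"
    if AB: "(A, B) \<in> pi_congruence n u" and m: "is_meet (biclosed_sets n) (\<subseteq>) A C M"
      "is_meet (biclosed_sets n) (\<subseteq>) B C M'" for A B C M M'
  proof -
    have M: "biclosed n M" "biclosed n M'" using m unfolding is_meet_def by blast+
    have AB': "pi_down n u A = pi_down n u B" using AB by (simp add: pi_congruence_def)
    have "pi_down n u M = pi_down n u M'"
      using meet[OF AB' M(1) m] meet[OF AB'[symmetric] M(2) m(2,1)] by (rule equalityI)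
    then show ?thesis using M by (simp add: pi_congruence_def)
  qed
  moreover have "(M, M') \<in> pi_congruence n u"
    if AB: "(A, B) \<in> pi_congruence n u" and m: "is_join (biclosed_sets n) (\<subseteq>) A C M"
      "is_join (biclosed_sets n) (\<subseteq>) B C M'" for A B C M M'
  proof -
    have M: "biclosed n M" "biclosed n M'" using m unfolding is_join_def by blast+
    have b: "biclosed n A" "biclosed n B" using AB by (simp_all add: pi_congruence_def)
    have AB': "pi_up n u A = pi_up n u B" using AB pi_up_cong by (simp add: pi_congruence_def)
    have "pi_up n u M = pi_up n u M'"
      using join[OF AB'[symmetric] b(1) M(2) m(2,1)] join[OF AB' b(2) M(1) m] by (rule equalityI)
    then show ?thesis using M pi_down_cong[OF M] by (simp add: pi_congruence_def)
  qed
  ultimately show ?thesis unfolding lattice_congruence_def by blast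
qed

section \<open>Forcing\<close>

text \<open>Joining with \<open>C\<close> absorbs \<open>A\<close> and sends \<open>B\<close> to
  \<open>J\<close>.\<close>

lemma congruence_join_above:
  assumes R: "lattice_congruence (biclosed_sets n) (\<subseteq>) R" and AB: "(A, B) \<in> R"
    and C: "biclosed n C" "A \<subseteq> C" and J: "is_join (biclosed_sets n) (\<subseteq>) B C J"
  shows "(C, J) \<in> R"
proof -
  have "is_join (biclosed_sets n) (\<subseteq>) A C C" using C by (simp add: is_join_def)
  then show ?thesis using R AB C(1) J unfolding lattice_congruence_def by blast
qed

lemma congruence_meet_below:
  assumes R: "lattice_congruence (biclosed_sets n) (\<subseteq>) R" and AB: "(A, B) \<in> R"
    and C: "biclosed n C" "C \<subseteq> B" and M: "is_meet (biclosed_sets n) (\<subseteq>) A C M"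
  shows "(M, C) \<in> R"
proof -
  have "is_meet (biclosed_sets n) (\<subseteq>) B C C" using C by (simp add: is_meet_def)
  then show ?thesis using R AB C(1) M unfolding lattice_congruence_def by blast
qed

lemma congruence_trans_sym:
  assumes R: "lattice_congruence (biclosed_sets n) (\<subseteq>) R"
  shows "(A, B) \<in> R \<Longrightarrow> (B, C) \<in> R \<Longrightarrow> (A, C) \<in> R" "(A, B) \<in> R \<Longrightarrow> (B, A) \<in> R"
    "biclosed n A \<Longrightarrow> (A, A) \<in> R" "(A, B) \<in> R \<Longrightarrow> biclosed n A \<and> biclosed n B"
proof -
  have e: "equiv (biclosed_sets n) R" using R by (simp add: lattice_congruence_def)
  show "(A, B) \<in> R \<Longrightarrow> (B, C) \<in> R \<Longrightarrow> (A, C) \<in> R" using e by (meson equivE transE)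
  show "(A, B) \<in> R \<Longrightarrow> (B, A) \<in> R" using e by (meson equivE symE)
  show "biclosed n A \<Longrightarrow> (A, A) \<in> R" using e by (simp add: equiv_def refl_on_def)
  show "(A, B) \<in> R \<Longrightarrow> biclosed n A \<and> biclosed n B" using e equiv_class_eq_iff by fastforce
qed

section \<open>The rank two intervals and what their edges force\<close>

definition below :: "int \<Rightarrow> int" where
  "below b = (if b = 1 then - 1 else b - 1)"

text \<open>In the interval generated by \<open>s_{b-1}\<close> and \<open>s_b\<close>,
  \<open>up_atom b\<close> belongs to the atom \<open>s_{b-1}\<close> and \<open>down_atom b\<close>
  to \<open>s_b\<close>. Adding \<open>across b\<close> gives the coatom above that atom.\<close>

definition up_atom :: "int \<Rightarrow> (int \<times> int) set" where
  "up_atom b = {(below b, b), (- b, - below b)}"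

definition down_atom :: "int \<Rightarrow> (int \<times> int) set" where
  "down_atom b = {(b, b + 1), (- b - 1, - b)}"

text \<open>For \<open>b = 1\<close> the interval is an octagon, whose coatoms have length 3; hence
  the extra pair, which is its own mirror.\<close>

definition across :: "int \<Rightarrow> (int \<times> int) set" where
  "across b = {(below b, b + 1), (- b - 1, - below b)} \<union> (if b = 1 then {(- 2, 2)} else {})"

text \<open>The inversion set of three consecutive blocks, each decreasing: the values below
  \<open>- b\<close>, from \<open>- b\<close> to \<open>b\<close>, and above
  \<open>b\<close>.\<close>

definition blocks :: "nat \<Rightarrow> int \<Rightarrow> (int \<times> int) set" where
  "blocks n b = {(a, c) \<in> pairs n. c < - b \<or> b < a \<or> (- b \<le> a \<and> c \<le> b)}"

text \<open>For positive \<open>b\<close>, the arrangement with \<open>b\<close> first,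
  \<open>- b\<close> last and all other values in decreasing order between them.\<close>

definition all_but :: "nat \<Rightarrow> int \<Rightarrow> (int \<times> int) set" where
  "all_but n b = {(a, c) \<in> pairs n. a \<noteq> b \<and> c \<noteq> - b}"

lemma biclosed_blocks: "1 \<le> b \<Longrightarrow> biclosed n (blocks n b)"
  by (rule biclosedI) (auto simp: blocks_def)

lemma biclosed_all_but: "b \<noteq> 0 \<Longrightarrow> biclosed n (all_but n b)"
  by (rule biclosedI) (auto simp: all_but_def)

lemma below_bounds: "1 \<le> b \<Longrightarrow> below b < b \<and> - b \<le> below b \<and> below b \<noteq> 0"
  by (auto simp: below_def)

lemma below_greatest: "x < b \<Longrightarrow> x \<noteq> 0 \<Longrightarrow> x \<le> below b"
  by (auto simp: below_def)

text \<open>The pairs of \<open>across b\<close> link the blocks. By transitivity with the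
  inversions inside the blocks they yield every pair between blocks, except those that start at
  \<open>b\<close> or end at \<open>- b\<close>.\<close>

lemma join_blocks:
  assumes b: "1 \<le> b" "b + 1 \<le> int n"
  shows "is_join (biclosed_sets n) (\<subseteq>) (up_atom b \<union> across b) (blocks n b) (all_but n b)"
proof -
  have pm: "b \<in> pmn n" "b + 1 \<in> pmn n" "below b \<in> pmn n"
    using b by (auto simp: pmn_def below_def)
  have "up_atom b \<union> across b \<subseteq> all_but n b"
    using b pm by (auto simp: up_atom_def across_def all_but_def below_def pmn_def split: if_splits)
  moreover have "blocks n b \<subseteq> all_but n b" using b by (auto simp: blocks_def all_but_def)
  moreover have "all_but n b \<subseteq> Z" if Z: "biclosed n Z" "up_atom b \<union> across b \<subseteq> Z" "blocks n b \<subseteq> Z" for Z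
  proof -
    note D = biclosedD[OF Z(1)]
    have pq: "(below b, b + 1) \<in> Z" using Z(2) by (auto simp: across_def)
    have mid_high: "(a, c) \<in> Z" if h: "a \<in> pmn n" "c \<in> pmn n" "- b \<le> a" "a < b" "b < c" for a c
    proof -
      have "a = below b \<or> (a, below b) \<in> blocks n b"
        using h pm below_bounds[OF b(1)] below_greatest[of a b] zero_notin_pmn[of n]
        by (cases "a = 0") (auto simp: blocks_def)
      then have "(a, b + 1) \<in> Z" using Z(3) D(4) pq by blast
      moreover have "c = b + 1 \<or> (b + 1, c) \<in> blocks n b"
        using h pm by (auto simp: blocks_def)
      ultimately show ?thesis using Z(3) D(4) by blast
    qed
    have low_mid: "(a, c) \<in> Z" if h: "a \<in> pmn n" "c \<in> pmn n" "a < - b" "- b < c" "c \<le> b" for a c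
      using D(3)[of "- c" "- a"] mid_high[of "- c" "- a"] h by simp
    \<comment> \<open>The chain passes through \<open>- below b\<close> and \<open>below b\<close>.
      For \<open>b = 1\<close> these are in the wrong order, and \<open>across b\<close> supplies
      the pair itself.\<close>
    have central: "(- b - 1, b + 1) \<in> Z"
    proof (cases "b = 1")
      case True
      then show ?thesis using Z(2) by (auto simp: across_def)
    next
      case False
      then have bb: "below b = b - 1" "2 \<le> b" using b by (auto simp: below_def)
      then have "(- below b, below b) \<in> blocks n b" using b by (auto simp: blocks_def pmn_def)
      moreover have "(- b - 1, - below b) \<in> Z" using Z(2) by (auto simp: across_def)
      ultimately show ?thesis using Z(3) D(4) pq by blast
    qed
    have low_high: "(a, c) \<in> Z" if h: "a \<in> pmn n" "c \<in> pmn n" "a < - b" "b < c" for a c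
    proof -
      have "- b - 1 \<in> pmn n" using b by (auto simp: pmn_def)
      then have "a = - b - 1 \<or> (a, - b - 1) \<in> blocks n b" "c = b + 1 \<or> (b + 1, c) \<in> blocks n b"
        using h pm by (auto simp: blocks_def)
      then show ?thesis using central Z(3) D(4) by blast
    qed
    show ?thesis
    proof (rule subrelI)
      fix a c assume h: "(a, c) \<in> all_but n b"
      then have p: "a \<in> pmn n" "c \<in> pmn n" "a < c" "a \<noteq> b" "c \<noteq> - b" by (auto simp: all_but_def)
      consider "c < - b \<or> b < a \<or> (- b \<le> a \<and> c \<le> b)" | "- b \<le> a" "a < b" "b < c"
        | "a < - b" "- b < c" "c \<le> b" | "a < - b" "b < c"
        using p by linarith
      then show "(a, c) \<in> Z"
        using p Z(3) mid_high low_mid low_high by cases (auto simp: blocks_def)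
    qed
  qed
  ultimately show ?thesis using biclosed_all_but[of b n] b by (auto simp: is_join_def)
qed

lemma blocks_all_but_congruent:
  assumes R: "lattice_congruence (biclosed_sets n) (\<subseteq>) R" and b: "1 \<le> b" "b + 1 \<le> int n"
    and gen: "(up_atom b, up_atom b \<union> across b) \<in> R"
  shows "(blocks n b, all_but n b) \<in> R"
proof (rule congruence_join_above[OF R gen biclosed_blocks[OF b(1)] _ join_blocks[OF b]])
  show "up_atom b \<subseteq> blocks n b"
    using b below_bounds[OF b(1)] by (auto simp: up_atom_def blocks_def below_def pmn_def)
qed

text \<open>For \<open>(- b, b) \<in> K\<close> this is the largest biclosed subset of \<open>all_but n b\<close> that agrees with \<open>K\<close>
  inside the blocks, so its meet with \<open>blocks n b\<close> lies below \<open>K\<close>.\<close>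

definition spread :: "nat \<Rightarrow> int \<Rightarrow> (int \<times> int) set \<Rightarrow> (int \<times> int) set" where
  "spread n b K = {(a, c) \<in> pairs n. ((a, c) \<in> blocks n b \<and> (a, c) \<in> K) \<or>
     (- b \<le> a \<and> a < b \<and> b < c \<and> (a, b) \<in> K) \<or>
     (a < - b \<and> - b < c \<and> c \<le> b \<and> (- b, c) \<in> K) \<or> (a < - b \<and> b < c)}"

lemma biclosed_Int_blocks:
  assumes K: "biclosed n K" and b: "1 \<le> b"
  shows "biclosed n (K \<inter> blocks n b)"
proof (rule biclosedI)
  note D = biclosedD[OF K] and B = biclosedD[OF biclosed_blocks[OF b, of n]]
  fix a c assume ac: "(a, c) \<in> K \<inter> blocks n b"
  show "(a, c) \<in> pairs n" using ac D(1) by blast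
  show "(- c, - a) \<in> K \<inter> blocks n b" using ac D(3) B(3) by blast
  fix d assume "d \<in> pmn n" "a < d" "d < c"
  moreover from this have "(a, d) \<in> blocks n b" "(d, c) \<in> blocks n b" using ac by (auto simp: blocks_def)
  ultimately show "(a, d) \<in> K \<inter> blocks n b \<or> (d, c) \<in> K \<inter> blocks n b" using ac D(5) by blast
next
  note D = biclosedD[OF K] and B = biclosedD[OF biclosed_blocks[OF b, of n]]
  fix a d c assume "(a, d) \<in> K \<inter> blocks n b" "(d, c) \<in> K \<inter> blocks n b"
  then show "(a, c) \<in> K \<inter> blocks n b" using D(4)[of a d c] B(4)[of a d c] by blast
qed

text \<open>The middle clauses admit \<open>a = b\<close> and \<open>c = - b\<close>, where both
  sides are false; this saves boundary cases below.\<close>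

lemma spread_iff:
  assumes b: "1 \<le> b" and ac: "a \<in> pmn n" "c \<in> pmn n" "a < c" and K: "biclosed n K"
  shows "c < - b \<or> b < a \<or> (- b \<le> a \<and> c \<le> b) \<Longrightarrow> (a, c) \<in> spread n b K \<longleftrightarrow> (a, c) \<in> K"
    and "- b \<le> a \<Longrightarrow> a \<le> b \<Longrightarrow> b < c \<Longrightarrow> (a, c) \<in> spread n b K \<longleftrightarrow> (a, b) \<in> K"
    and "a < - b \<Longrightarrow> - b \<le> c \<Longrightarrow> c \<le> b \<Longrightarrow> (a, c) \<in> spread n b K \<longleftrightarrow> (- b, c) \<in> K"
    and "a < - b \<Longrightarrow> b < c \<Longrightarrow> (a, c) \<in> spread n b K"
  using b ac biclosedD(2)[OF K, of a b] biclosedD(2)[OF K, of "- b" c]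
  unfolding spread_def blocks_def by auto

text \<open>As an arrangement: the middle block keeps its order from \<open>K\<close>, the high
  block stands right after \<open>b\<close> and the low block right before \<open>- b\<close>. Since
  \<open>(- b, b) \<in> K\<close>, \<open>b\<close> precedes \<open>- b\<close>, so the high block
  precedes the low one.\<close>

lemma biclosed_spread:
  assumes K: "biclosed n K" and b: "1 \<le> b" "b \<in> pmn n" and bK: "(- b, b) \<in> K"
  shows "biclosed n (spread n b K)"
proof (rule biclosedI)
  note D = biclosedD[OF K] and iff = spread_iff[OF b(1) _ _ _ K]
  fix a c assume ac: "(a, c) \<in> spread n b K"
  show acp: "(a, c) \<in> pairs n" using ac by (simp add: spread_def)
  then have p: "a \<in> pmn n" "c \<in> pmn n" "a < c" "- c \<in> pmn n" "- a \<in> pmn n" "- c < - a" by auto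
  note i = iff[OF p(1-3)] and i' = iff[OF p(4-6)]
  consider (block) "c < - b \<or> b < a \<or> (- b \<le> a \<and> c \<le> b)" | (mh) "- b \<le> a" "a \<le> b" "b < c"
    | (lm) "a < - b" "- b \<le> c" "c \<le> b" | (lh) "a < - b" "b < c"
    using p by linarith
  note cs = this
  from cs show "(- c, - a) \<in> spread n b K"
  proof cases
    case block
    then have "- a < - b \<or> b < - c \<or> (- b \<le> - c \<and> - a \<le> b)" by linarith
    then show ?thesis using i(1)[OF block] i'(1) ac D(3) by blast
  next
    case mh
    then have "(- b, - a) \<in> K" using i(2) ac D(3) by blast
    then show ?thesis using i'(3) mh by simp
  next
    case lm
    then have "(- c, b) \<in> K" using i(3) ac D(3)[of "- b" c] by simp
    then show ?thesis using i'(2) lm by simp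
  next
    case lh
    then show ?thesis using i'(4) by simp
  qed
  fix d assume d: "d \<in> pmn n" "a < d" "d < c"
  note ad = iff[OF p(1) d(1,2)] and dc = iff[OF d(1) p(2) d(3)]
  from cs show "(a, d) \<in> spread n b K \<or> (d, c) \<in> spread n b K"
  proof cases
    case block
    then have "d < - b \<or> b < a \<or> (- b \<le> a \<and> d \<le> b)" "c < - b \<or> b < d \<or> (- b \<le> d \<and> c \<le> b)"
      using d by linarith+
    then show ?thesis using ad(1) dc(1) i(1)[OF block] ac D(5)[OF _ d] by blast
  next
    case mh
    then have abK: "(a, b) \<in> K" using i(2) ac by blast
    consider "d < b" | "d = b" | "b < d" by linarith
    then show ?thesis
    proof cases
      case 1
      then have "(a, d) \<in> K \<or> (d, b) \<in> K" using D(5)[OF abK d(1,2)] by blast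
      then show ?thesis using ad(1) dc(2) mh d 1 by auto
    next
      case 2 then show ?thesis using ad(1) abK mh by auto
    next
      case 3 then show ?thesis using ad(2) abK mh by auto
    qed
  next
    case lm
    then have cK: "(- b, c) \<in> K" using i(3) ac by blast
    consider "d < - b" | "d = - b" | "- b < d" by linarith
    then show ?thesis
    proof cases
      case 1 then show ?thesis using dc(3) cK lm by auto
    next
      case 2 then show ?thesis using dc(1) cK lm by auto
    next
      case 3
      then have "(- b, d) \<in> K \<or> (d, c) \<in> K" using D(5)[OF cK d(1) _ d(3)] by blast
      then show ?thesis using ad(3) dc(1) lm d 3 by auto
    qed
  next
    case lh
    consider "d < - b" | "b < d" | "- b \<le> d" "d \<le> b" by linarith
    then show ?thesis
    proof cases
      case 1 then show ?thesis using dc(4) lh by auto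
    next
      case 2 then show ?thesis using ad(4) lh by auto
    next
      case 3
      then have "(- b, d) \<in> K \<or> (d, b) \<in> K"
        using D(5)[OF bK d(1)] bK by (cases "d = b \<or> d = - b") auto
      then show ?thesis using ad(3) dc(2) lh 3 by auto
    qed
  qed
next
  note D = biclosedD[OF K] and iff = spread_iff[OF b(1) _ _ _ K]
  fix a d c assume h: "(a, d) \<in> spread n b K" "(d, c) \<in> spread n b K"
  have p: "a \<in> pmn n" "c \<in> pmn n" "d \<in> pmn n" "a < d" "d < c" "a < c"
    using h by (auto simp: spread_def)
  note ac = iff[OF p(1,2,6)] and ad = iff[OF p(1,3,4)] and dc = iff[OF p(3,2,5)]
  consider (block) "c < - b \<or> b < a \<or> (- b \<le> a \<and> c \<le> b)" | (mh) "- b \<le> a" "a \<le> b" "b < c"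
    | (lm) "a < - b" "- b \<le> c" "c \<le> b" | (lh) "a < - b" "b < c"
    using p by linarith
  then show "(a, c) \<in> spread n b K"
  proof cases
    case block
    then have "d < - b \<or> b < a \<or> (- b \<le> a \<and> d \<le> b)" "c < - b \<or> b < d \<or> (- b \<le> d \<and> c \<le> b)"
      using p by linarith+
    then show ?thesis using ad(1) dc(1) ac(1)[OF block] h D(4) by blast
  next
    case mh
    show ?thesis
    proof (cases "d \<le> b")
      case True
      then have "(a, d) \<in> K" "(d, b) \<in> K" using ad(1) dc(2) mh p h by auto
      then show ?thesis using ac(2) mh D(4) by blast
    next
      case False
      then show ?thesis using ad(2) ac(2) mh h by auto
    qed
  next
    case lm
    show ?thesis
    proof (cases "- b \<le> d")
      case True
      then have "(- b, d) \<in> K" "(d, c) \<in> K" using ad(3) dc(1) lm p h by auto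
      then show ?thesis using ac(3) lm D(4) by blast
    next
      case False
      then show ?thesis using dc(3) ac(3) lm h by auto
    qed
  next
    case lh
    then show ?thesis using ac(4) by blast
  qed
qed

text \<open>Meeting with \<open>Z\<close> identifies \<open>K \<inter> blocks n b\<close> with
  \<open>Z\<close>; joining with \<open>K\<close> identifies \<open>K\<close> with a set
  \<open>J\<close> that contains \<open>(a, c)\<close>; meeting with \<open>W\<close> identifies
  \<open>V\<close> with \<open>W\<close>.\<close>

lemma swap_congruent_aux:
  assumes R: "lattice_congruence (biclosed_sets n) (\<subseteq>) R"
    and XY: "(blocks n b, all_but n b) \<in> R" and b: "1 \<le> b" "b \<in> pmn n"
    and V: "biclosed n V" and W: "biclosed n W" "W = V \<union> {(a, c), (- c, - a)}"
    and K: "biclosed n K" "V \<subseteq> K" "(a, c) \<notin> K" "(- b, b) \<in> K" "(a, b) \<in> K"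
    and abc: "a < b" "b < c"
  shows "(V, W) \<in> R"
proof -
  define Z where "Z = spread n b K"
  have Z: "biclosed n Z" unfolding Z_def by (rule biclosed_spread[OF K(1) b K(4)])
  have ac: "(a, c) \<in> pairs n" using biclosedD(1)[OF W(1)] W(2) by blast
  have ZX: "Z \<inter> blocks n b = K \<inter> blocks n b"
    using b biclosedD(1)[OF K(1)] unfolding Z_def spread_def blocks_def by auto
  have "Z \<subseteq> all_but n b"
    using b unfolding Z_def spread_def blocks_def all_but_def by auto
  then have 1: "(K \<inter> blocks n b, Z) \<in> R"
  proof (rule congruence_meet_below[OF R XY Z])
    show "is_meet (biclosed_sets n) (\<subseteq>) (blocks n b) Z (K \<inter> blocks n b)"
      using ZX biclosed_Int_blocks[OF K(1) b(1)] unfolding is_meet_def by blast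
  qed
  obtain J where J: "is_join (biclosed_sets n) (\<subseteq>) Z K J" using biclosed_join[OF Z K(1)] .
  then have J': "biclosed n J" "Z \<subseteq> J" "K \<subseteq> J" by (simp_all add: is_join_def)
  have 2: "(K, J) \<in> R" by (rule congruence_join_above[OF R 1 K(1) _ J]) blast
  \<comment> \<open>For \<open>- b \<le> a\<close> this comes from \<open>(a, b) \<in> K\<close>;
    for \<open>a < - b\<close> it is a pair from the low to the high block.\<close>
  have "(a, c) \<in> Z"
    using K(5) abc ac unfolding Z_def spread_def by auto
  then have "(a, c) \<in> J" "(- c, - a) \<in> J" using J' biclosedD(3)[OF J'(1)] by blast+
  then have WJ: "W \<subseteq> J" using W(2) K(2) J'(3) by blast
  show ?thesis
  proof (rule congruence_meet_below[OF R 2 W(1) WJ])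
    \<comment> \<open>A lower bound omits \<open>(a, c)\<close> because \<open>K\<close> does, and
      then its mirror by symmetry.\<close>
    have "T \<subseteq> V" if T: "biclosed n T" "T \<subseteq> K" "T \<subseteq> W" for T
    proof -
      have "(a, c) \<notin> T" using T K(3) by blast
      moreover from this have "(- c, - a) \<notin> T" using biclosedD(3)[OF T(1), of "- c" "- a"] by auto
      ultimately show ?thesis using T(3) W(2) by blast
    qed
    then show "is_meet (biclosed_sets n) (\<subseteq>) K W V"
      using V K(2) W(2) unfolding is_meet_def by blast
  qed
qed

text \<open>The added pairs make the entries at positions from \<open>- m\<close> to
  \<open>m\<close> decreasing; the window is symmetric about the centre.\<close>

lemma biclosed_sort_middle:
  assumes V: "biclosed n V" and p: "inj p" "\<And>x. p (- x) = - p x" "V = {(a, c) \<in> pairs n. p c < p a}"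
  shows "biclosed n (V \<union> {(x, y) \<in> pairs n. \<bar>p x\<bar> \<le> m \<and> \<bar>p y\<bar> \<le> (m :: int)})"
proof (rule biclosedI)
  fix a c assume "(a, c) \<in> V \<union> {(x, y) \<in> pairs n. \<bar>p x\<bar> \<le> m \<and> \<bar>p y\<bar> \<le> m}"
  then show "(- c, - a) \<in> V \<union> {(x, y) \<in> pairs n. \<bar>p x\<bar> \<le> m \<and> \<bar>p y\<bar> \<le> m}"
    by (auto simp: p(2,3))
next
  fix a d c assume "(a, d) \<in> V \<union> {(x, y) \<in> pairs n. \<bar>p x\<bar> \<le> m \<and> \<bar>p y\<bar> \<le> m}"
    "(d, c) \<in> V \<union> {(x, y) \<in> pairs n. \<bar>p x\<bar> \<le> m \<and> \<bar>p y\<bar> \<le> m}"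
  then show "(a, c) \<in> V \<union> {(x, y) \<in> pairs n. \<bar>p x\<bar> \<le> m \<and> \<bar>p y\<bar> \<le> m}"
    unfolding p(3) by (simp add: case_prod_beta) linarith
next
  fix a d c assume "(a, c) \<in> V \<union> {(x, y) \<in> pairs n. \<bar>p x\<bar> \<le> m \<and> \<bar>p y\<bar> \<le> m}"
    "d \<in> pmn n" "a < d" "d < c"
  then show "(a, d) \<in> V \<union> {(x, y) \<in> pairs n. \<bar>p x\<bar> \<le> m \<and> \<bar>p y\<bar> \<le> m} \<or>
    (d, c) \<in> V \<union> {(x, y) \<in> pairs n. \<bar>p x\<bar> \<le> m \<and> \<bar>p y\<bar> \<le> m}"
    unfolding p(3) by (simp add: case_prod_beta) linarith
qed (auto simp: p(3))

text \<open>If \<open>b\<close> comes after \<open>- b\<close>, the entries between them are first sorted decreasingly.\<close>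

lemma swap_congruent:
  assumes R: "lattice_congruence (biclosed_sets n) (\<subseteq>) R"
    and gen: "(up_atom b, up_atom b \<union> across b) \<in> R" and b: "1 \<le> b"
    and V: "biclosed n V" and W: "biclosed n W" "W = V \<union> {(a, c), (- c, - a)}"
    and abc: "a < b" "b < c" "(a, c) \<notin> V" "(b, c) \<notin> V"
  shows "(V, W) \<in> R"
proof -
  have ac: "a \<in> pmn n" "c \<in> pmn n" using biclosedD(2)[OF W(1), of a c] W(2) by auto
  have bn: "b + 1 \<le> int n" "b \<in> pmn n" using ac abc b by (auto simp: pmn_def)
  note XY = blocks_all_but_congruent[OF R b bn(1) gen]
  \<comment> \<open>\<open>W\<close> contains \<open>(a, c)\<close> but not \<open>(b, c)\<close>,
    so it contains \<open>(a, b)\<close>, which is not one of the two new pairs.\<close>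
  have "(b, c) \<notin> W" using W(2) abc b by auto
  then have "(a, b) \<in> W" using biclosedD(5)[OF W(1), of a c b] W(2) abc bn(2) by auto
  then have ab: "(a, b) \<in> V" using W(2) abc by auto
  show ?thesis
  proof (cases "(- b, b) \<in> V")
    case True
    show ?thesis by (rule swap_congruent_aux[OF R XY b bn(2) V W V _ abc(3) True ab abc(1,2)]) simp
  next
    case False
    obtain p :: "int \<Rightarrow> int"
      where p: "inj p" "\<And>x. p (- x) = - p x" "V = {(a, c) \<in> pairs n. p c < p a}"
      by (rule biclosed_positions[OF V]) (rule that)
    define K where "K = V \<union> {(x, y) \<in> pairs n. \<bar>p x\<bar> \<le> p b \<and> \<bar>p y\<bar> \<le> p b}"
    have K: "biclosed n K" unfolding K_def by (rule biclosed_sort_middle[OF V p])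
    \<comment> \<open>As \<open>c\<close> stands right of \<open>b\<close>, it lies outside the
      sorted window, so \<open>(a, c)\<close> stays uninverted in \<open>K\<close>.\<close>
    have "p c \<noteq> p b" using p(1) abc by (auto dest: injD)
    then have "p b < p c" using abc bn(2) ac by (auto simp: p(3))
    then have 1: "(a, c) \<notin> K" using abc(3) by (auto simp: K_def)
    have "0 \<le> p b" using False b bn(2) by (auto simp: p(2,3))
    then have 2: "(- b, b) \<in> K" using b bn(2) by (auto simp: K_def p(2))
    show ?thesis
      by (rule swap_congruent_aux[OF R XY b bn(2) V W K _ 1 2 _ abc(1,2)]) (use ab in \<open>auto simp: K_def\<close>)
  qed
qed

section \<open>Inversion sets of the generating pairs of the congruence\<close>

lemma inversions_gen:
  "i < n \<Longrightarrow> inversions n (gen i) = {(prev_pos i, int i + 1), (- int i - 1, - prev_pos i)}"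
  using inversions_comp_gen[OF id_Bn, of i n] prev_pos_less[of i] by (simp add: inversions_id)

lemma inversions_comp_gen':
  assumes "w \<in> Bn n" "i < n" "w (prev_pos i) = x" "w (int i + 1) = y" "x < y"
  shows "inversions n (w \<circ> gen i) = inversions n w \<union> {(x, y), (- y, - x)}"
  using inversions_comp_gen[of w n i] assms by simp

lemma inversions_up_words:
  assumes b: "1 \<le> b" "b < n"
  shows "inversions n (gen (b - 1)) = up_atom (int b)"
    and "inversions n (word_prod (alt_word (b - 1) b (coxm b - 1))) = up_atom (int b) \<union> across (int b)"
proof -
  have pp: "prev_pos (b - 1) = below (int b)" "int (b - 1) + 1 = int b" "- int (b - 1) - 1 = - int b"
    using b by (auto simp: prev_pos_def below_def)
  have b': "b - 1 < n" using b by simp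
  show 1: "inversions n (gen (b - 1)) = up_atom (int b)"
    using inversions_gen[OF b'] unfolding pp up_atom_def .
  show "inversions n (word_prod (alt_word (b - 1) b (coxm b - 1))) = up_atom (int b) \<union> across (int b)"
  proof (cases "b = 1")
    case True
    have g: "gen 0 \<in> Bn n" "gen (Suc 0) \<in> Bn n" using b True by (auto intro: gen_Bn)
    \<comment> \<open>The bond of order 4 gives a word of three letters. The unsimplified
      \<open>- (- 1)\<close> keeps the shape \<open>(- y, - x)\<close> of the rule.\<close>
    have "inversions n (gen 0 \<circ> gen (Suc 0)) = inversions n (gen 0) \<union> {(- 1, 2), (- 2, - (- 1))}"
      by (rule inversions_comp_gen'[OF g(1)])
        (use b True in \<open>auto simp: gen_def prev_pos_def Transposition.transpose_def\<close>)
    moreover have "inversions n (gen 0 \<circ> gen (Suc 0) \<circ> gen 0) =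
        inversions n (gen 0 \<circ> gen (Suc 0)) \<union> {(- 2, 2), (- 2, - (- 2))}"
      by (rule inversions_comp_gen'[OF comp_Bn[OF g]])
        (use b True in \<open>auto simp: gen_def prev_pos_def Transposition.transpose_def\<close>)
    moreover have "word_prod (alt_word (b - 1) b (coxm b - 1)) = gen 0 \<circ> gen (Suc 0) \<circ> gen 0"
      by (simp add: True coxm_def numeral_eq_Suc fun_eq_iff)
    ultimately show ?thesis using 1 True by (auto simp: across_def below_def)
  next
    case False
    have "inversions n (gen (b - 1) \<circ> gen b) =
        inversions n (gen (b - 1)) \<union> {(int b - 1, int b + 1), (- (int b + 1), - (int b - 1))}"
      by (rule inversions_comp_gen'[OF gen_Bn[OF b']])
        (use b False in \<open>auto simp: gen_def prev_pos_def Transposition.transpose_def\<close>)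
    moreover have "word_prod (alt_word (b - 1) b (coxm b - 1)) = gen (b - 1) \<circ> gen b"
      using False by (simp add: coxm_def numeral_eq_Suc fun_eq_iff)
    ultimately show ?thesis using 1 False by (auto simp: across_def below_def)
  qed
qed

lemma inversions_down_words:
  assumes b: "1 \<le> b" "b < n"
  shows "inversions n (gen b) = down_atom (int b)"
    and "inversions n (word_prod (alt_word b (b - 1) (coxm b - 1))) = down_atom (int b) \<union> across (int b)"
proof -
  show 1: "inversions n (gen b) = down_atom (int b)"
    using inversions_gen[OF b(2)] b by (simp add: prev_pos_def down_atom_def)
  have b': "b - 1 < n" using b by simp
  show "inversions n (word_prod (alt_word b (b - 1) (coxm b - 1))) = down_atom (int b) \<union> across (int b)"
  proof (cases "b = 1")
    case True
    have g: "gen 0 \<in> Bn n" "gen (Suc 0) \<in> Bn n" using b True by (auto intro: gen_Bn)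
    have "inversions n (gen (Suc 0) \<circ> gen 0) = inversions n (gen (Suc 0)) \<union> {(- 2, 2), (- 2, - (- 2))}"
      by (rule inversions_comp_gen'[OF g(2)])
        (use b True in \<open>auto simp: gen_def prev_pos_def Transposition.transpose_def\<close>)
    moreover have "inversions n (gen (Suc 0) \<circ> gen 0 \<circ> gen (Suc 0)) =
        inversions n (gen (Suc 0) \<circ> gen 0) \<union> {(- 2, 1), (- 1, - (- 2))}"
      by (rule inversions_comp_gen'[OF comp_Bn[OF g(2,1)]])
        (use b True in \<open>auto simp: gen_def prev_pos_def Transposition.transpose_def\<close>)
    moreover have "word_prod (alt_word b (b - 1) (coxm b - 1)) = gen (Suc 0) \<circ> gen 0 \<circ> gen (Suc 0)"
      by (simp add: True coxm_def numeral_eq_Suc fun_eq_iff)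
    ultimately show ?thesis using 1 True by (auto simp: across_def below_def)
  next
    case False
    have "inversions n (gen b \<circ> gen (b - 1)) =
        inversions n (gen b) \<union> {(int b - 1, int b + 1), (- (int b + 1), - (int b - 1))}"
      by (rule inversions_comp_gen'[OF gen_Bn[OF b(2)] b'])
        (use b False in \<open>auto simp: gen_def prev_pos_def Transposition.transpose_def\<close>)
    moreover have "word_prod (alt_word b (b - 1) (coxm b - 1)) = gen b \<circ> gen (b - 1)"
      using False by (simp add: coxm_def numeral_eq_Suc fun_eq_iff)
    ultimately show ?thesis using 1 False by (auto simp: across_def below_def)
  qed
qed

lemma alt_word_is_word: "i < n \<Longrightarrow> j < n \<Longrightarrow> is_word n (alt_word i j k)"
  by (induction i j k rule: alt_word.induct) auto

section \<open>Duality by complementation\<close>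

definition dual_congruence :: "nat \<Rightarrow> (int \<times> int) set rel \<Rightarrow> (int \<times> int) set rel" where
  "dual_congruence n R = {(A, B). biclosed n A \<and> biclosed n B \<and> (pairs n - A, pairs n - B) \<in> R}"

lemma is_meet_compl:
  assumes "biclosed n A" "biclosed n C" "is_meet (biclosed_sets n) (\<subseteq>) A C M"
  shows "is_join (biclosed_sets n) (\<subseteq>) (pairs n - A) (pairs n - C) (pairs n - M)"
proof -
  have M: "biclosed n M" "M \<subseteq> A" "M \<subseteq> C"
    "\<And>Z. biclosed n Z \<Longrightarrow> Z \<subseteq> A \<Longrightarrow> Z \<subseteq> C \<Longrightarrow> Z \<subseteq> M"
    using assms(3) unfolding is_meet_def by blast+
  have "pairs n - M \<subseteq> Z" if "biclosed n Z" "pairs n - A \<subseteq> Z" "pairs n - C \<subseteq> Z" for Z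
    using M(4)[OF biclosed_compl[OF that(1)]] that(2,3) by blast
  then show ?thesis using M biclosed_compl[OF M(1)] unfolding is_join_def by blast
qed

lemma is_join_compl:
  assumes "biclosed n A" "biclosed n C" "is_join (biclosed_sets n) (\<subseteq>) A C M"
  shows "is_meet (biclosed_sets n) (\<subseteq>) (pairs n - A) (pairs n - C) (pairs n - M)"
proof -
  have M: "biclosed n M" "A \<subseteq> M" "C \<subseteq> M"
    "\<And>Z. biclosed n Z \<Longrightarrow> A \<subseteq> Z \<Longrightarrow> C \<subseteq> Z \<Longrightarrow> M \<subseteq> Z"
    using assms(3) unfolding is_join_def by blast+
  have "Z \<subseteq> pairs n - M" if Z: "biclosed n Z" "Z \<subseteq> pairs n - A" "Z \<subseteq> pairs n - C" for Z
    using M(4)[OF biclosed_compl[OF Z(1)]] Z(2,3) biclosedD(1)[OF Z(1)]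
      biclosedD(1)[OF assms(1)] biclosedD(1)[OF assms(2)] by blast
  then show ?thesis using M biclosed_compl[OF M(1)] unfolding is_meet_def by blast
qed

lemma lattice_congruence_dual:
  assumes R: "lattice_congruence (biclosed_sets n) (\<subseteq>) R"
  shows "lattice_congruence (biclosed_sets n) (\<subseteq>) (dual_congruence n R)"
proof -
  note c = congruence_trans_sym[OF R]
  have "equiv (biclosed_sets n) (dual_congruence n R)"
  proof (rule equivI)
    show "dual_congruence n R \<subseteq> biclosed_sets n \<times> biclosed_sets n" by (auto simp: dual_congruence_def)
    show "refl_on (biclosed_sets n) (dual_congruence n R)"
      by (auto simp: refl_on_def dual_congruence_def intro: c(3) biclosed_compl)
    show "sym (dual_congruence n R)" by (auto simp: sym_def dual_congruence_def intro: c(2))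
    show "trans (dual_congruence n R)" unfolding trans_def dual_congruence_def using c(1) by blast
  qed
  moreover have "(M, M') \<in> dual_congruence n R"
    if AB: "(A, B) \<in> dual_congruence n R" and C: "biclosed n C"
      and m: "is_meet (biclosed_sets n) (\<subseteq>) A C M" "is_meet (biclosed_sets n) (\<subseteq>) B C M'"
    for A B C M M'
  proof -
    have ab: "biclosed n A" "biclosed n B" "(pairs n - A, pairs n - B) \<in> R"
      using AB by (simp_all add: dual_congruence_def)
    have "pairs n - C \<in> biclosed_sets n" using biclosed_compl[OF C] by simp
    then have "(pairs n - M, pairs n - M') \<in> R"
      using R ab(3) is_meet_compl[OF ab(1) C m(1)] is_meet_compl[OF ab(2) C m(2)]
      unfolding lattice_congruence_def by blast
    moreover have "biclosed n M" "biclosed n M'" using m unfolding is_meet_def by blast+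
    ultimately show ?thesis by (simp add: dual_congruence_def)
  qed
  moreover have "(M, M') \<in> dual_congruence n R"
    if AB: "(A, B) \<in> dual_congruence n R" and C: "biclosed n C"
      and m: "is_join (biclosed_sets n) (\<subseteq>) A C M" "is_join (biclosed_sets n) (\<subseteq>) B C M'"
    for A B C M M'
  proof -
    have ab: "biclosed n A" "biclosed n B" "(pairs n - A, pairs n - B) \<in> R"
      using AB by (simp_all add: dual_congruence_def)
    have "pairs n - C \<in> biclosed_sets n" using biclosed_compl[OF C] by simp
    then have "(pairs n - M, pairs n - M') \<in> R"
      using R ab(3) is_join_compl[OF ab(1) C m(1)] is_join_compl[OF ab(2) C m(2)]
      unfolding lattice_congruence_def by blast
    moreover have "biclosed n M" "biclosed n M'" using m unfolding is_join_def by blast+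
    ultimately show ?thesis by (simp add: dual_congruence_def)
  qed
  ultimately show ?thesis unfolding lattice_congruence_def by blast
qed

lemma biclosed_up_atom:
  assumes "1 \<le> b" "b + 1 \<le> int n"
  shows "biclosed n (up_atom b)" "biclosed n (up_atom b \<union> across b)"
proof -
  define k where "k = nat b"
  have k: "b = int k" "1 \<le> k" "k < n" "k - 1 < n" using assms by (auto simp: k_def)
  show "biclosed n (up_atom b)"
    unfolding k(1) inversions_up_words(1)[OF k(2,3), symmetric]
    by (intro biclosed_inversions gen_Bn k)
  show "biclosed n (up_atom b \<union> across b)"
    unfolding k(1) inversions_up_words(2)[OF k(2,3), symmetric]
    by (intro biclosed_inversions word_prod_Bn alt_word_is_word k)
qed

text \<open>The same polygon edge at the top of the lattice, which is where complementation sends it.\<close>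

lemma up_atom_dual_congruence:
  assumes R: "lattice_congruence (biclosed_sets n) (\<subseteq>) R" and b: "1 \<le> b" "b + 1 \<le> int n"
    and gen: "(down_atom b, down_atom b \<union> across b) \<in> R"
  shows "(up_atom b, up_atom b \<union> across b) \<in> dual_congruence n R"
proof -
  note c = congruence_trans_sym[OF R] and B = biclosed_up_atom[OF b]
  have dn: "down_atom b \<union> across b \<subseteq> pairs n" using c(4)[OF gen] biclosedD(1) by blast
  have disj: "down_atom b \<inter> (up_atom b \<union> across b) = {}" "across b \<inter> up_atom b = {}"
    using b by (auto simp: down_atom_def up_atom_def across_def below_def split: if_splits)
  \<comment> \<open>The complement of \<open>up_atom b \<union> across b\<close> contains
    \<open>down_atom b\<close>, and joining it with the larger side of the generator adds exactly
    \<open>across b\<close>.\<close>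
  have "(pairs n - (up_atom b \<union> across b), pairs n - up_atom b) \<in> R"
  proof (rule congruence_join_above[OF R gen])
    show "biclosed n (pairs n - (up_atom b \<union> across b))" by (rule biclosed_compl[OF B(2)])
    show "down_atom b \<subseteq> pairs n - (up_atom b \<union> across b)" using dn disj by blast
    show "is_join (biclosed_sets n) (\<subseteq>) (down_atom b \<union> across b)
        (pairs n - (up_atom b \<union> across b)) (pairs n - up_atom b)"
      unfolding is_join_def using biclosed_compl[OF B(1)] dn disj by auto
  qed
  then show ?thesis using B c(2) by (simp add: dual_congruence_def)
qed

text \<open>No entry stands between \<open>a\<close> and \<open>c\<close>, so transitivity cannot
  produce a removed pair. If the last clause of \<open>biclosed\<close> offers a removed pair,
  adjacency puts the remaining entry beyond both of its entries, so the other candidate is an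
  inversion.\<close>

lemma biclosed_remove_adjacent:
  assumes W: "biclosed n W" and ac: "(a, c) \<in> W"
    and p: "inj p" "\<And>x. p (- x) = - p x" "W = {(x, y) \<in> pairs n. p y < (p x :: int)}"
    and adj: "\<And>d. d \<in> pmn n \<Longrightarrow> \<not> (p c < p d \<and> p d < p a)"
  shows "biclosed n (W - {(a, c), (- c, - a)})"
proof (rule biclosedI)
  note D = biclosedD[OF W]
  have adj': "\<not> (p (- a) < p d \<and> p d < p (- c))" if "d \<in> pmn n" for d
    using adj[of "- d"] that unfolding p(2) by auto
  have acp: "a \<in> pmn n" "c \<in> pmn n" "a < c" using D(2)[OF ac] by auto
  have mem: "(x, y) \<in> W \<longleftrightarrow> x \<in> pmn n \<and> y \<in> pmn n \<and> x < y \<and> p y < p x" for x y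
    by (subst p(3)) auto
  have peq: "p x = p y \<longleftrightarrow> x = y" for x y using p(1) by (auto dest: injD)
  fix x z assume xz: "(x, z) \<in> W - {(a, c), (- c, - a)}"
  show "(x, z) \<in> pairs n" using xz D(1) by blast
  show "(- z, - x) \<in> W - {(a, c), (- c, - a)}" using xz D(3)[of x z] by auto
  have xz': "x \<in> pmn n" "z \<in> pmn n" "x < z" "p z < p x" using xz mem by auto
  fix d assume d: "d \<in> pmn n" "x < d" "d < z"
  have "(x, d) \<in> W \<or> (d, z) \<in> W" using D(5)[of x z d] xz d by blast
  moreover have "(d, z) \<in> W - {(a, c), (- c, - a)}" if "(x, d) = (a, c)"
  proof -
    have "\<not> p c < p z" "p z \<noteq> p c" using adj[OF xz'(2)] xz' d that peq by auto
    then show ?thesis using that xz' d acp mem by auto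
  qed
  moreover have "(d, z) \<in> W - {(a, c), (- c, - a)}" if "(x, d) = (- c, - a)"
  proof -
    have "\<not> p (- a) < p z" "p z \<noteq> p (- a)" using adj'[OF xz'(2)] xz' d that peq by auto
    then show ?thesis using that xz' d acp mem by auto
  qed
  moreover have "(x, d) \<in> W - {(a, c), (- c, - a)}" if "(d, z) = (a, c)"
  proof -
    have "\<not> p x < p a" "p x \<noteq> p a" using adj[OF xz'(1)] xz' d that peq by auto
    then show ?thesis using that xz' d acp mem by auto
  qed
  moreover have "(x, d) \<in> W - {(a, c), (- c, - a)}" if "(d, z) = (- c, - a)"
  proof -
    have "\<not> p x < p (- c)" "p x \<noteq> p (- c)" using adj'[OF xz'(1)] xz' d that peq by auto
    then show ?thesis using that xz' d acp mem by auto
  qed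
  ultimately show "(x, d) \<in> W - {(a, c), (- c, - a)} \<or> (d, z) \<in> W - {(a, c), (- c, - a)}" by blast
next
  have adj': "\<not> (p (- a) < p d \<and> p d < p (- c))" if "d \<in> pmn n" for d
    using adj[of "- d"] that unfolding p(2) by auto
  have mem: "(x, y) \<in> W \<longleftrightarrow> x \<in> pmn n \<and> y \<in> pmn n \<and> x < y \<and> p y < p x" for x y
    by (subst p(3)) auto
  fix x d z assume h: "(x, d) \<in> W - {(a, c), (- c, - a)}" "(d, z) \<in> W - {(a, c), (- c, - a)}"
  then have "(x, z) \<in> W" using biclosedD(4)[OF W] by blast
  moreover have "d \<in> pmn n" "p d < p x" "p z < p d" using h mem by auto
  ultimately show "(x, z) \<in> W - {(a, c), (- c, - a)}" using adj adj' by auto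
qed

text \<open>The condition at a down value \<open>b\<close> is the mirror image of the condition at
  the up value \<open>- b\<close>.\<close>

lemma pi_down_fixed_iff:
  assumes W: "biclosed n W" and u: "odd_pred n u"
  shows "pi_down n u W = W \<longleftrightarrow>
    (\<forall>a b c. (a, c) \<in> W \<longrightarrow> b \<in> pmn n \<longrightarrow> a < b \<longrightarrow> b < c \<longrightarrow> u b \<longrightarrow> (b, c) \<in> W)"
proof
  assume eq: "pi_down n u W = W"
  have "(b, c) \<in> W" if "(a, c) \<in> W" "b \<in> pmn n" "a < b" "b < c" "u b" for a b c
    using pi_down_up[of a c n u W b] that unfolding eq by blast
  then show "\<forall>a b c. (a, c) \<in> W \<longrightarrow> b \<in> pmn n \<longrightarrow> a < b \<longrightarrow> b < c \<longrightarrow> u b \<longrightarrow> (b, c) \<in> W" by blast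
next
  note D = biclosedD[OF W]
  assume up: "\<forall>a b c. (a, c) \<in> W \<longrightarrow> b \<in> pmn n \<longrightarrow> a < b \<longrightarrow> b < c \<longrightarrow> u b \<longrightarrow> (b, c) \<in> W"
  have "W \<subseteq> pi_down n u W"
  proof (rule pi_down_greatest[OF subset_refl D(1)])
    fix a b c assume h: "(a, c) \<in> W" "b \<in> pmn n" "a < b" "b < c"
    show "(b, c) \<in> W" if "u b" using up h that by blast
    show "(a, b) \<in> W" if "\<not> u b"
    proof -
      have "u (- b)" using that u h(2) by (simp add: odd_pred_def)
      moreover have "(- c, - a) \<in> W" "- b \<in> pmn n" "- c < - b" "- b < - a"
        using h D(3) by auto
      ultimately have "(- b, - a) \<in> W" using up by blast
      then show ?thesis using D(3)[of "- b" "- a"] by simp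
    qed
  qed
  then show "pi_down n u W = W" using pi_down_subset by blast
qed

text \<open>Induction on the size of \<open>W\<close>: if \<open>W\<close> is not fixed, it has an
  adjacent inversion whose removal, together with its mirror, stays in the fibre and in the class of
  \<open>R\<close>.\<close>

lemma pi_down_congruent:
  assumes R: "lattice_congruence (biclosed_sets n) (\<subseteq>) R" and u: "odd_pred n u"
    and up: "\<And>b. 1 \<le> b \<Longrightarrow> b + 1 \<le> int n \<Longrightarrow> u b \<Longrightarrow> (up_atom b, up_atom b \<union> across b) \<in> R"
    and down: "\<And>b. 1 \<le> b \<Longrightarrow> b + 1 \<le> int n \<Longrightarrow> \<not> u b \<Longrightarrow> (down_atom b, down_atom b \<union> across b) \<in> R"
    and W: "biclosed n W"
  shows "(pi_down n u W, W) \<in> R"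
  using W
proof (induction "card W" arbitrary: W rule: less_induct)
  case less
  note W = less.prems
  note D = biclosedD[OF W] and c = congruence_trans_sym[OF R]
  show ?case
  proof (cases "pi_down n u W = W")
    case True
    then show ?thesis using c(3)[OF W] by simp
  next
    case False
    then obtain a0 b c0 where b: "b \<in> pmn n" "u b" and
      abc0: "(a0, c0) \<in> W" "a0 < b" "b < c0" "(b, c0) \<notin> W"
      unfolding pi_down_fixed_iff[OF W u] by blast
    obtain p :: "int \<Rightarrow> int"
      where p: "inj p" "\<And>x. p (- x) = - p x" "W = {(a, c) \<in> pairs n. p c < p a}"
      by (rule biclosed_positions[OF W]) (rule that)
    have mem: "(x, y) \<in> W \<longleftrightarrow> x \<in> pmn n \<and> y \<in> pmn n \<and> x < y \<and> p y < p x" for x y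
      by (subst p(3)) auto
    \<comment> \<open>Among the inversions with the up value \<open>b\<close> between them in size
      and left of both, one with closest positions is taken. An entry \<open>d\<close> between them
      would give a closer one: \<open>(a, d)\<close> if \<open>b < d\<close>, \<open>(d, c)\<close>
      if \<open>d < b\<close>.\<close>
    let ?P = "\<lambda>x. x \<in> W \<and> fst x < b \<and> b < snd x \<and> (b, snd x) \<notin> W"
    have "?P (a0, c0)" using abc0 by simp
    from ex_has_least_nat[of ?P, OF this, of "\<lambda>x. nat (p (fst x) - p (snd x))"]
    obtain x where x: "?P x" "\<And>y. ?P y \<Longrightarrow>
        nat (p (fst x) - p (snd x)) \<le> nat (p (fst y) - p (snd y))"
      by blast
    obtain a c where xac: "x = (a, c)" by (metis surj_pair)
    have ac: "(a, c) \<in> W" "a < b" "b < c" "(b, c) \<notin> W" using x(1) xac by auto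
    have acp: "a \<in> pmn n" "c \<in> pmn n" "a < c" "p c < p a" using ac(1) mem by auto
    have "p b \<noteq> p c" using p(1) ac(3) by (auto dest: injD)
    then have bc: "p b < p c" using ac mem b(1) acp by auto
    have adj: "\<not> (p c < p d \<and> p d < p a)" if d: "d \<in> pmn n" for d
    proof
      assume h: "p c < p d \<and> p d < p a"
      then have "d \<noteq> b" using bc by auto
      then consider "b < d" | "d < b" by linarith
      then show False
      proof cases
        case 1
        then have "?P (a, d)" using h bc mem d ac acp by auto
        then show False using x(2)[of "(a, d)"] xac h by auto
      next
        case 2
        then have "?P (d, c)" using h bc mem d ac acp by auto
        then show False using x(2)[of "(d, c)"] xac h by auto
      qed
    qed
    define V where "V = W - {(a, c), (- c, - a)}"
    have V: "biclosed n V" unfolding V_def by (rule biclosed_remove_adjacent[OF W ac(1) p adj])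
    have WV: "W = V \<union> {(a, c), (- c, - a)}" using ac(1) D(3)[OF ac(1)] by (auto simp: V_def)
    have VW: "(V, W) \<in> R"
    proof (cases "0 < b")
      case True
      have "1 \<le> b" "b + 1 \<le> int n" using True ac acp by (auto simp: pmn_def)
      then show ?thesis
        using swap_congruent[OF R up _ V W WV ac(2,3)] b(2) ac(4) by (simp add: V_def)
    next
      case False
      \<comment> \<open>Now \<open>- b\<close> is positive and down, so its generator has the down
        form and becomes one of up form in the dual congruence.\<close>
      have bb: "1 \<le> - b" "- b + 1 \<le> int n" using False b(1) ac acp by (auto simp: pmn_def)
      have "\<not> u (- b)" using u b by (simp add: odd_pred_def)
      then have gen: "(up_atom (- b), up_atom (- b) \<union> across (- b)) \<in> dual_congruence n R"
        using up_atom_dual_congruence[OF R bb] down[OF bb] by blast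
      \<comment> \<open>Complementing exchanges the roles of \<open>V\<close> and \<open>W\<close>;
        the pair to swap is then \<open>(- c, - a)\<close>, with \<open>- b\<close> between its
        entries.\<close>
      have W': "pairs n - V = (pairs n - W) \<union> {(- c, - a), (- (- a), - (- c))}"
        using WV D(1) V_def by auto
      have "(a, b) \<in> W" using D(5)[OF ac(1) b(1) ac(2,3)] ac(4) by blast
      then have "(- b, - a) \<notin> pairs n - W" "(- c, - a) \<notin> pairs n - W"
        using D(3) ac(1) by blast+
      then have "(pairs n - W, pairs n - V) \<in> dual_congruence n R"
        using swap_congruent[OF lattice_congruence_dual[OF R] gen bb(1) biclosed_compl[OF W]
            biclosed_compl[OF V] W'] ac(2,3) by simp
      moreover have "pairs n - (pairs n - W) = W" "pairs n - (pairs n - V) = V"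
        using D(1) biclosedD(1)[OF V] by blast+
      ultimately show ?thesis using c(2) by (simp add: dual_congruence_def)
    qed
    \<comment> \<open>Raising the left end of \<open>(a, c)\<close> to \<open>b\<close> would leave
      \<open>W\<close>, so the bottom of \<open>W\<close> omits this pair and its mirror and is the
      bottom of \<open>V\<close> as well.\<close>
    have "pi_down n u W \<subseteq> V"
    proof -
      have 1: "(a, c) \<notin> pi_down n u W"
        using pi_down_up[of a c n u W b] b ac pi_down_subset[of n u W] by blast
      have "(- c, - a) \<notin> pi_down n u W"
      proof
        assume "(- c, - a) \<in> pi_down n u W"
        from biclosedD(3)[OF biclosed_pi_down[OF W u] this] show False using 1 by simp
      qed
      then show ?thesis using 1 pi_down_subset[of n u W] unfolding V_def by blast
    qed
    from pi_down_mono[OF this, of n u] have "pi_down n u W \<subseteq> pi_down n u V" by (simp add: pi_down_idem)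
    moreover have "pi_down n u V \<subseteq> pi_down n u W" by (rule pi_down_mono) (auto simp: V_def)
    ultimately have eq: "pi_down n u V = pi_down n u W" by blast
    have "card V < card W"
      using ac(1) by (intro psubset_card_mono finite_biclosed[OF W]) (auto simp: V_def)
    then have "(pi_down n u V, V) \<in> R" using less.hyps V by blast
    then show ?thesis using VW c(1) eq by metis
  qed
qed

section \<open>The Cambrian congruence\<close>

lemma pi_congruenceI:
  assumes "biclosed n A" "biclosed n B" "A \<subseteq> B" "pi_down n u B \<subseteq> A"
  shows "(A, B) \<in> pi_congruence n u"
proof -
  have "pi_down n u B \<subseteq> pi_down n u A" using pi_down_mono[OF assms(4), of n u] by (simp add: pi_down_idem)
  then show ?thesis using pi_down_mono[OF assms(3), of n u] assms(1,2) by (auto simp: pi_congruence_def)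
qed

text \<open>The projection drops all of \<open>across b\<close>: raising the left end of
  \<open>(x, b + 1)\<close> to the up value \<open>b\<close> would give the missing pair
  \<open>(b, b + 1)\<close>, and mirror images go along.\<close>

lemma up_atom_pi_congruence:
  assumes b: "1 \<le> b" "b + 1 \<le> int n" and u: "odd_pred n u" "u b"
  shows "(up_atom b, up_atom b \<union> across b) \<in> pi_congruence n u"
proof (rule pi_congruenceI[OF biclosed_up_atom[OF b] Un_upper1])
  define P where "P = pi_down n u (up_atom b \<union> across b)"
  have PS: "P \<subseteq> up_atom b \<union> across b" unfolding P_def by (rule pi_down_subset)
  have pm: "b \<in> pmn n" using b by (auto simp: pmn_def)
  have no: "(b, b + 1) \<notin> up_atom b \<union> across b"
    using b by (auto simp: up_atom_def across_def below_def split: if_splits)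
  have 1: "(x, b + 1) \<notin> P" if "x < b" for x
    unfolding P_def using pi_down_up[of x "b + 1" n u _ b] pm u(2) that no pi_down_subset[of n u "up_atom b \<union> across b"]
    by auto
  then have "(below b, b + 1) \<notin> P" using below_bounds[OF b(1)] by blast
  moreover from this have "(- b - 1, - below b) \<notin> P"
    using biclosedD(3)[OF biclosed_pi_down[OF biclosed_up_atom(2)[OF b] u(1)], of "- b - 1" "- below b"] unfolding P_def by (auto simp: add.commute)
  moreover have "(- 2, 2) \<notin> P" if "b = 1" using 1[of "- 2"] that by simp
  ultimately have "x \<notin> P" if "x \<in> across b" for x
    using that unfolding across_def by (auto split: if_splits)
  then show "pi_down n u (up_atom b \<union> across b) \<subseteq> up_atom b" using PS unfolding P_def by blast
qed

lemma biclosed_down_atom: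
  assumes "1 \<le> b" "b + 1 \<le> int n"
  shows "biclosed n (down_atom b)" "biclosed n (down_atom b \<union> across b)"
proof -
  define k where "k = nat b"
  have k: "b = int k" "1 \<le> k" "k < n" "k - 1 < n" using assms by (auto simp: k_def)
  show "biclosed n (down_atom b)"
    unfolding k(1) inversions_down_words(1)[OF k(2,3), symmetric]
    by (intro biclosed_inversions gen_Bn k)
  show "biclosed n (down_atom b \<union> across b)"
    unfolding k(1) inversions_down_words(2)[OF k(2,3), symmetric]
    by (intro biclosed_inversions word_prod_Bn alt_word_is_word k)
qed

lemma down_atom_pi_congruence:
  assumes b: "1 \<le> b" "b + 1 \<le> int n" and u: "odd_pred n u" "\<not> u b"
  shows "(down_atom b, down_atom b \<union> across b) \<in> pi_congruence n u"
proof (rule pi_congruenceI[OF biclosed_down_atom[OF b] Un_upper1])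
  define P where "P = pi_down n u (down_atom b \<union> across b)"
  have PS: "P \<subseteq> down_atom b \<union> across b" unfolding P_def by (rule pi_down_subset)
  have pm: "b \<in> pmn n" using b by (auto simp: pmn_def)
  have no: "(below b, b) \<notin> down_atom b \<union> across b"
    using b by (auto simp: down_atom_def across_def below_def split: if_splits)
  \<comment> \<open>Lowering the right end to the down value \<open>b\<close> would give the missing
    pair \<open>(below b, b)\<close>.\<close>
  have 1: "(below b, y) \<notin> P" if "b < y" for y
    unfolding P_def using pi_down_down[of "below b" y n u _ b] pm u(2) that no below_bounds[OF b(1)]
      pi_down_subset[of n u "down_atom b \<union> across b"]
    by auto
  then have "(below b, b + 1) \<notin> P" by simp
  moreover from this have "(- b - 1, - below b) \<notin> P"
    using biclosedD(3)[OF biclosed_pi_down[OF biclosed_down_atom(2)[OF b] u(1)], of "- b - 1" "- below b"] unfolding P_def by (auto simp: add.commute)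
  moreover have "(- 2, 2) \<notin> P" if b1: "b = 1"
  proof
    assume "(- 2, 2) \<in> P"
    \<comment> \<open>As 1 is down, \<open>- 1\<close> is up, and raising the left end to it gives
      \<open>(below 1, 2)\<close>, already excluded.\<close>
    moreover have "- 1 \<in> pmn n" "u (- 1)" using pm u b1 by (auto simp: odd_pred_def)
    ultimately have "(- 1, 2) \<in> P" unfolding P_def using pi_down_up[of "- 2" 2 n u _ "- 1"] by simp
    then show False using 1[of 2] b1 by (simp add: below_def)
  qed
  ultimately have "x \<notin> P" if "x \<in> across b" for x
    using that unfolding across_def by (auto split: if_splits)
  then show "pi_down n u (down_atom b \<union> across b) \<subseteq> down_atom b" using PS unfolding P_def by blast
qed

section \<open>Pattern avoidance as a fixed point condition\<close>

lemma odd_pred_is_up: "odd_pred n (is_up up)"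
  by (auto simp: odd_pred_def is_up_def pmn_def)

lemma sorted_positions: "sorted_wrt (<) ([- int n..- 1] @ [1..int n])"
  by (auto simp: sorted_wrt_append)

lemma sorted_wrt_less_nth_iff:
  fixes xs :: "int list"
  assumes "sorted_wrt (<) xs" "p < length xs" "q < length xs"
  shows "xs ! p < xs ! q \<longleftrightarrow> p < q"
  using assms sorted_wrt_nth_less[OF assms(1)] by (metis linorder_neqE_nat order_less_asym)

text \<open>The three places of a pattern carry values \<open>b\<close>, \<open>c\<close>,
  \<open>a\<close> in this order with \<open>a < b < c\<close> and \<open>b\<close> up: precisely an
  inverted \<open>(a, c)\<close> with \<open>(b, c)\<close> not inverted.\<close>

lemma avoids_iff_pi_down_fixed:
  assumes w: "w \<in> Bn n"
  shows "avoids_231bar up (full_notation n w) \<longleftrightarrow>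
    pi_down n (is_up up) (inversions n w) = inversions n w"
proof -
  define ps where "ps = [- int n..- 1] @ [1..int n]"
  have set_ps: "set ps = pmn n" by (auto simp: ps_def pmn_def)
  have less: "ps ! p < ps ! q \<longleftrightarrow> p < q" if "p < length ps" "q < length ps" for p q
    using sorted_wrt_less_nth_iff sorted_positions that unfolding ps_def by blast
  have fn: "full_notation n w = map w ps" by (simp add: full_notation_def ps_def)
  have mem: "(x, y) \<in> inversions n w \<longleftrightarrow> x \<in> pmn n \<and> y \<in> pmn n \<and> x < y \<and> inv w y < inv w x" for x y
    by (auto simp: inversions_def)
  have "(\<exists>p q r. p < q \<and> q < r \<and> r < length ps \<and> w (ps ! r) < w (ps ! p) \<and>
      w (ps ! p) < w (ps ! q) \<and> is_up up (w (ps ! p))) \<longleftrightarrow>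
    (\<exists>a b c. (a, c) \<in> inversions n w \<and> b \<in> pmn n \<and> a < b \<and> b < c \<and> is_up up b \<and> (b, c) \<notin> inversions n w)"
    (is "?L \<longleftrightarrow> ?R")
  proof
    assume ?L
    then obtain p q r where h: "p < q" "q < r" "r < length ps" "w (ps ! r) < w (ps ! p)"
      "w (ps ! p) < w (ps ! q)" "is_up up (w (ps ! p))" by blast
    have "ps ! p \<in> pmn n" "ps ! q \<in> pmn n" "ps ! r \<in> pmn n"
      using h set_ps nth_mem by (metis order_less_trans)+
    moreover have "ps ! p < ps ! q" "ps ! q < ps ! r" using h less by auto
    ultimately have "(w (ps ! r), w (ps ! q)) \<in> inversions n w" "w (ps ! p) \<in> pmn n"
      "(w (ps ! p), w (ps ! q)) \<notin> inversions n w"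
      using h w by (auto simp: mem)
    then show ?R using h by blast
  next
    assume ?R
    then obtain a b c where h: "(a, c) \<in> inversions n w" "b \<in> pmn n" "a < b" "b < c" "is_up up b"
      "(b, c) \<notin> inversions n w" by blast
    have ac: "a \<in> pmn n" "c \<in> pmn n" "inv w c < inv w a" using h(1) mem by auto
    have "inv w b \<noteq> inv w c" using h(4) w by (metis Bn_f_inv order_less_irrefl)
    then have bc: "inv w b < inv w c" using h mem ac by auto
    have "inv w a \<in> set ps" "inv w b \<in> set ps" "inv w c \<in> set ps"
      using ac h(2) inv_Bn[OF w] set_ps by auto
    then obtain p q r where i: "p < length ps" "q < length ps" "r < length ps"
      "ps ! p = inv w b" "ps ! q = inv w c" "ps ! r = inv w a"
      by (metis in_set_conv_nth)
    then have "p < q" "q < r" using less[of p q] less[of q r] bc ac by auto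
    then show ?L using i h w by (intro exI[of _ p] exI[of _ q] exI[of _ r]) auto
  qed
  moreover have "avoids_231bar up (full_notation n w) \<longleftrightarrow>
    \<not> (\<exists>p q r. p < q \<and> q < r \<and> r < length ps \<and> w (ps ! r) < w (ps ! p) \<and>
      w (ps ! p) < w (ps ! q) \<and> is_up up (w (ps ! p)))"
    unfolding avoids_231bar_def fn length_map
    by (intro arg_cong[of _ _ Not] ex_cong1) auto
  ultimately show ?thesis
    unfolding pi_down_fixed_iff[OF biclosed_inversions[OF w] odd_pred_is_up] by blast
qed

section \<open>Transport between biclosed sets and signed permutations\<close>

lemma lattice_congruence_image:
  assumes f: "bij_betw f A B" and le: "\<And>x y. x \<in> A \<Longrightarrow> y \<in> A \<Longrightarrow> le' (f x) (f y) \<longleftrightarrow> le x y"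
    and R: "lattice_congruence A le R"
  shows "lattice_congruence B le' ((\<lambda>(x, y). (f x, f y)) ` R)"
proof -
  have e: "equiv A R" using R by (simp add: lattice_congruence_def)
  have RA: "x \<in> A \<and> y \<in> A" if "(x, y) \<in> R" for x y
    using e that by (meson equiv_class_eq_iff)
  have inj: "f x = f y \<longleftrightarrow> x = y" if "x \<in> A" "y \<in> A" for x y
    using f that by (meson bij_betw_imp_inj_on inj_on_eq_iff)
  have B: "B = f ` A" using f by (simp add: bij_betw_def)
  have meet: "is_meet A le x y m" if "x \<in> A" "y \<in> A" "m \<in> A" "is_meet B le' (f x) (f y) (f m)" for x y m
    using that le unfolding is_meet_def B by simp
  have join: "is_join A le x y m" if "x \<in> A" "y \<in> A" "m \<in> A" "is_join B le' (f x) (f y) (f m)" for x y m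
    using that le unfolding is_join_def B by simp
  let ?R = "(\<lambda>(x, y). (f x, f y)) ` R"
  have "equiv B ?R"
  proof (rule equivI)
    show "?R \<subseteq> B \<times> B" using RA B by auto
    show "refl_on B ?R"
      using e unfolding refl_on_def B equiv_def by force
    show "sym ?R" using e unfolding sym_def equiv_def by fast
    show "trans ?R"
    proof (rule transI)
      fix X Y Z assume "(X, Y) \<in> ?R" "(Y, Z) \<in> ?R"
      then obtain x y y' z where h: "(x, y) \<in> R" "(y', z) \<in> R" "X = f x" "Y = f y" "Y = f y'" "Z = f z"
        by auto
      then have "y = y'" using inj RA by metis
      then have "(x, z) \<in> R" using e h by (meson equivE transE)
      then show "(X, Z) \<in> ?R" using h by force
    qed
  qed
  moreover have "(M, M') \<in> ?R"
    if XY: "(X, Y) \<in> ?R" and Z: "Z \<in> B" and m: "is_meet B le' X Z M" "is_meet B le' Y Z M'" for X Y Z M M'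
  proof -
    obtain x y where xy: "(x, y) \<in> R" "X = f x" "Y = f y" using XY by auto
    obtain z m1 m2 where z: "z \<in> A" "m1 \<in> A" "m2 \<in> A" "Z = f z" "M = f m1" "M' = f m2"
      using Z m unfolding is_meet_def B by blast
    have "is_meet A le x z m1" "is_meet A le y z m2"
      using meet[of x z m1] meet[of y z m2] m RA[OF xy(1)] xy z by auto
    then have "(m1, m2) \<in> R" using R xy(1) z(1) unfolding lattice_congruence_def by blast
    then show ?thesis using z by force
  qed
  moreover have "(M, M') \<in> ?R"
    if XY: "(X, Y) \<in> ?R" and Z: "Z \<in> B" and m: "is_join B le' X Z M" "is_join B le' Y Z M'" for X Y Z M M'
  proof -
    obtain x y where xy: "(x, y) \<in> R" "X = f x" "Y = f y" using XY by auto
    obtain z m1 m2 where z: "z \<in> A" "m1 \<in> A" "m2 \<in> A" "Z = f z" "M = f m1" "M' = f m2"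
      using Z m unfolding is_join_def B by blast
    have "is_join A le x z m1" "is_join A le y z m2"
      using join[of x z m1] join[of y z m2] m RA[OF xy(1)] xy z by auto
    then have "(m1, m2) \<in> R" using R xy(1) z(1) unfolding lattice_congruence_def by blast
    then show ?thesis using z by force
  qed
  ultimately show ?thesis unfolding lattice_congruence_def by blast
qed

lemma bij_betw_inversions: "bij_betw (inversions n) (Bn n) (biclosed_sets n)"
  unfolding bij_betw_def inj_on_def
  using inversions_inj biclosed_inversions biclosed_realisable by blast

lemma camb_gens_inversions:
  "(\<lambda>(v, w). (inversions n v, inversions n w)) ` camb_gens n up =
    {(up_atom b, up_atom b \<union> across b) | b. 1 \<le> b \<and> b + 1 \<le> int n \<and> is_up up b} \<union>
    {(down_atom b, down_atom b \<union> across b) | b. 1 \<le> b \<and> b + 1 \<le> int n \<and> \<not> is_up up b}"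
  (is "?L = ?R")
proof
  show "?L \<subseteq> ?R"
  proof
    fix x assume "x \<in> ?L"
    then obtain b where b: "1 \<le> b" "b \<le> n - 1" and x: "x = (inversions n (gen (edge_tgt up b)),
        inversions n (word_prod (alt_word (edge_tgt up b) (edge_src up b) (coxm b - 1))))"
      unfolding camb_gens_def by auto
    have b': "1 \<le> b" "b < n" using b by auto
    show "x \<in> ?R"
    proof (cases "up b")
      case True
      then have "x = (up_atom (int b), up_atom (int b) \<union> across (int b))" "is_up up (int b)"
        using x inversions_up_words[OF b'] b' by (simp_all add: edge_tgt_def edge_src_def is_up_def)
      then show ?thesis using b' by force
    next
      case False
      then have "x = (down_atom (int b), down_atom (int b) \<union> across (int b))" "\<not> is_up up (int b)"
        using x inversions_down_words[OF b'] b' by (simp_all add: edge_tgt_def edge_src_def is_up_def)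
      then show ?thesis using b' by force
    qed
  qed
  have mem: "(inversions n (gen (edge_tgt up k)),
      inversions n (word_prod (alt_word (edge_tgt up k) (edge_src up k) (coxm k - 1)))) \<in> ?L"
    if "1 \<le> k" "k < n" for k
    using that unfolding camb_gens_def by force
  show "?R \<subseteq> ?L"
  proof
    fix x assume "x \<in> ?R"
    then obtain b where b: "1 \<le> b" "b + 1 \<le> int n" and
      x: "is_up up b \<and> x = (up_atom b, up_atom b \<union> across b) \<or>
        \<not> is_up up b \<and> x = (down_atom b, down_atom b \<union> across b)"
      by auto
    define k where "k = nat b"
    have k: "b = int k" "1 \<le> k" "k < n" using b by (auto simp: k_def)
    show "x \<in> ?L"
      using mem[OF k(2,3)] x inversions_up_words[OF k(2,3)] inversions_down_words[OF k(2,3)] k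
      by (auto simp: edge_tgt_def edge_src_def is_up_def)
  qed
qed

lemma camb_gens_Bn: "camb_gens n up \<subseteq> Bn n \<times> Bn n"
  by (auto simp: camb_gens_def edge_tgt_def edge_src_def
      intro!: gen_Bn word_prod_Bn alt_word_is_word)

text \<open>The fibre relation is a congruence containing the generators, so it contains
  \<open>Theta\<close>. Conversely, every congruence with the generators links each element to the
  bottom of its fibre. Both arguments are carried across the order isomorphism
  \<open>inversions\<close>.\<close>

lemma Theta_eq:
  "Theta n up = {(v, w). v \<in> Bn n \<and> w \<in> Bn n \<and>
     pi_down n (is_up up) (inversions n v) = pi_down n (is_up up) (inversions n w)}"
  (is "_ = ?Q")
proof
  let ?I = "inversions n" and ?u = "is_up up"
  define g where "g = inv_into (Bn n) ?I"
  have g: "bij_betw g (biclosed_sets n) (Bn n)"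
    unfolding g_def by (rule bij_betw_inv_into[OF bij_betw_inversions])
  have gI: "g (?I w) = w" if "w \<in> Bn n" for w
    unfolding g_def using that bij_betw_inversions by (meson bij_betw_imp_inj_on inv_into_f_f)
  have Ig: "?I (g S) = S" "g S \<in> Bn n" if "biclosed n S" for S
    using that bij_betw_inv_into_right[OF bij_betw_inversions] g unfolding g_def
    by (auto dest: bij_betwE)
  have pc: "(x, y) \<in> pi_congruence n ?u" if "(x, y) \<in> (\<lambda>(v, w). (?I v, ?I w)) ` camb_gens n up" for x y
    using that up_atom_pi_congruence down_atom_pi_congruence odd_pred_is_up
    unfolding camb_gens_inversions by blast
  have "lattice_congruence (Bn n) (weak_le n) ((\<lambda>(x, y). (g x, g y)) ` pi_congruence n ?u)"
    by (rule lattice_congruence_image[OF g _ lattice_congruence_pi[OF odd_pred_is_up]])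
      (simp add: weak_le_iff Ig)
  moreover have "(\<lambda>(x, y). (g x, g y)) ` pi_congruence n ?u = ?Q"
  proof
    show "(\<lambda>(x, y). (g x, g y)) ` pi_congruence n ?u \<subseteq> ?Q"
      by (auto simp: pi_congruence_def Ig)
    show "?Q \<subseteq> (\<lambda>(x, y). (g x, g y)) ` pi_congruence n ?u"
    proof
      fix x assume "x \<in> ?Q"
      then obtain v w where x: "x = (v, w)" "v \<in> Bn n" "w \<in> Bn n" "pi_down n ?u (?I v) = pi_down n ?u (?I w)"
        by auto
      then have "(?I v, ?I w) \<in> pi_congruence n ?u" by (simp add: pi_congruence_def biclosed_inversions)
      then show "x \<in> (\<lambda>(x, y). (g x, g y)) ` pi_congruence n ?u"
        using gI x by (intro image_eqI[of _ _ "(?I v, ?I w)"]) auto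
    qed
  qed
  moreover have "camb_gens n up \<subseteq> ?Q"
  proof clarify
    fix v w assume vw: "(v, w) \<in> camb_gens n up"
    then have "(?I v, ?I w) \<in> pi_congruence n ?u" by (intro pc) force
    then show "v \<in> Bn n \<and> w \<in> Bn n \<and> pi_down n ?u (?I v) = pi_down n ?u (?I w)"
      using vw camb_gens_Bn by (auto simp: pi_congruence_def)
  qed
  ultimately show "Theta n up \<subseteq> ?Q"
    unfolding Theta_def gen_congruence_def by auto
  show "?Q \<subseteq> Theta n up"
    unfolding Theta_def gen_congruence_def
  proof (rule Inter_greatest)
    fix R assume "R \<in> {R. lattice_congruence (Bn n) (weak_le n) R \<and> camb_gens n up \<subseteq> R}"
    then have R: "lattice_congruence (Bn n) (weak_le n) R" "camb_gens n up \<subseteq> R" by auto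
    let ?R = "(\<lambda>(v, w). (?I v, ?I w)) ` R"
    have R': "lattice_congruence (biclosed_sets n) (\<subseteq>) ?R"
      by (rule lattice_congruence_image[OF bij_betw_inversions _ R(1)]) (simp add: weak_le_iff)
    have gens: "(\<lambda>(v, w). (?I v, ?I w)) ` camb_gens n up \<subseteq> ?R" using R(2) by (rule image_mono)
    have bottom: "(pi_down n ?u (?I w), ?I w) \<in> ?R" if "w \<in> Bn n" for w
      by (rule pi_down_congruent[OF R' odd_pred_is_up _ _ biclosed_inversions[OF that]])
        (use gens in \<open>unfold camb_gens_inversions, blast+\<close>)
    show "?Q \<subseteq> R"
    proof clarify
      fix v w assume vw: "v \<in> Bn n" "w \<in> Bn n" "pi_down n ?u (?I v) = pi_down n ?u (?I w)"
      then have "(?I v, ?I w) \<in> ?R"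
        using bottom congruence_trans_sym(1,2)[OF R'] by metis
      then obtain v' w' where h: "(v', w') \<in> R" "?I v = ?I v'" "?I w = ?I w'" by auto
      have "equiv (Bn n) R" using R(1) by (simp add: lattice_congruence_def)
      then have "v' \<in> Bn n" "w' \<in> Bn n" using h(1) by (meson equiv_class_eq_iff)+
      then show "(v, w) \<in> R" using h vw inversions_inj by metis
    qed
  qed
qed

text \<open>A class is sent to the common value of \<open>h\<close> on it. Comparable
  representatives have comparable values by monotonicity, and the values are themselves
  representatives by idempotence.\<close>

lemma kernel_quotient_iso:
  assumes h: "\<And>x. x \<in> A \<Longrightarrow> h x \<in> A \<and> h (h x) = h x"
    and mono: "\<And>x y. x \<in> A \<Longrightarrow> y \<in> A \<Longrightarrow> le x y \<Longrightarrow> le (h x) (h y)"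
    and R: "R = {(x, y). x \<in> A \<and> y \<in> A \<and> h x = h y}"
  shows "\<exists>f. bij_betw f (A // R) {x \<in> A. h x = x} \<and>
    (\<forall>X\<in>A // R. \<forall>Y\<in>A // R. quot_le le X Y \<longleftrightarrow> le (f X) (f Y))"
proof (intro exI conjI ballI)
  let ?f = "\<lambda>X. the_elem (h ` X)"
  have cl: "R `` {x} = {y \<in> A. h y = h x}" if "x \<in> A" for x using that R by auto
  have f: "?f (R `` {x}) = h x" if "x \<in> A" for x
  proof -
    have "h ` (R `` {x}) = {h x}" using cl[OF that] that by auto
    then show ?thesis by simp
  qed
  show "bij_betw ?f (A // R) {x \<in> A. h x = x}"
  proof (rule bij_betw_imageI)
    show "inj_on ?f (A // R)"
    proof (rule inj_onI)
      fix X Y assume "X \<in> A // R" "Y \<in> A // R" and eq: "?f X = ?f Y"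
      then obtain x y where "x \<in> A" "y \<in> A" "X = R `` {x}" "Y = R `` {y}" by (auto elim!: quotientE)
      then show "X = Y" using eq f cl by simp
    qed
    show "?f ` (A // R) = {x \<in> A. h x = x}"
    proof
      show "?f ` (A // R) \<subseteq> {x \<in> A. h x = x}" using f h by (auto elim!: quotientE)
      show "{x \<in> A. h x = x} \<subseteq> ?f ` (A // R)"
      proof
        fix x assume x: "x \<in> {x \<in> A. h x = x}"
        then show "x \<in> ?f ` (A // R)"
          using f[of x] by (intro image_eqI[of _ _ "R `` {x}"] quotientI) auto
      qed
    qed
  qed
  fix X Y assume "X \<in> A // R" "Y \<in> A // R"
  then obtain x y where xy: "x \<in> A" "y \<in> A" "X = R `` {x}" "Y = R `` {y}" by (auto elim!: quotientE)
  show "quot_le le X Y \<longleftrightarrow> le (?f X) (?f Y)"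
  proof
    assume "quot_le le X Y"
    then obtain x' y' where "x' \<in> A" "y' \<in> A" "h x' = h x" "h y' = h y" "le x' y'"
      using xy cl unfolding quot_le_def by auto
    then show "le (?f X) (?f Y)" using mono[of x' y'] f xy by simp
  next
    assume "le (?f X) (?f Y)"
    moreover have "h x \<in> X" "h y \<in> Y" using xy cl h by auto
    ultimately show "quot_le le X Y" using f xy unfolding quot_le_def by auto
  qed
qed

theorem theorem7p5:
  fixes n :: nat and up :: "nat \<Rightarrow> bool"
  assumes "n \<ge> 1"
  shows "\<exists>f. bij_betw f (cambrian n up) (avoiders n up) \<and>
    (\<forall>X\<in>cambrian n up. \<forall>Y\<in>cambrian n up.
       quot_le (weak_le n) X Y \<longleftrightarrow> weak_le n (f X) (f Y))"
proof -
  let ?I = "inversions n" and ?u = "is_up up"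
  \<comment> \<open>The projection \<open>pi_down\<close> read on signed permutations; its values
    are biclosed, so they have preimages under \<open>inversions\<close>.\<close>
  define h where "h w = inv_into (Bn n) ?I (pi_down n ?u (?I w))" for w
  have Ih: "?I (h w) = pi_down n ?u (?I w)" "h w \<in> Bn n" if "w \<in> Bn n" for w
  proof -
    have "pi_down n ?u (?I w) \<in> biclosed_sets n"
      using biclosed_pi_down[OF biclosed_inversions[OF that] odd_pred_is_up] by simp
    then show "?I (h w) = pi_down n ?u (?I w)" "h w \<in> Bn n"
      unfolding h_def using bij_betw_inversions
      by (metis bij_betw_inv_into_right, metis bij_betw_def inv_into_into)
  qed
  have h_eq: "h v = h w \<longleftrightarrow> pi_down n ?u (?I v) = pi_down n ?u (?I w)" if "v \<in> Bn n" "w \<in> Bn n" for v w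
    using Ih[OF that(1)] Ih[OF that(2)] inversions_inj by (metis h_def)
  have fixed: "h w = w \<longleftrightarrow> pi_down n ?u (?I w) = ?I w" if "w \<in> Bn n" for w
    using Ih[OF that] inversions_inj that by metis
  have "avoiders n up = {w \<in> Bn n. h w = w}"
    by (auto simp: avoiders_def avoids_iff_pi_down_fixed fixed)
  moreover have "Theta n up = {(v, w). v \<in> Bn n \<and> w \<in> Bn n \<and> h v = h w}"
    unfolding Theta_eq using h_eq by blast
  moreover have "weak_le n (h v) (h w)" if "v \<in> Bn n" "w \<in> Bn n" "weak_le n v w" for v w
    using that Ih by (simp add: weak_le_iff pi_down_mono)
  moreover have "h w \<in> Bn n \<and> h (h w) = h w" if "w \<in> Bn n" for w
    using Ih[OF that] by (simp add: fixed pi_down_idem)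
  ultimately show ?thesis
    unfolding cambrian_def using kernel_quotient_iso[of "Bn n" h "weak_le n" "Theta n up"] by simp
qed

end
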